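(* Let $G$ be a group and $N$ a normal subgroup. For every $c\in\mathcal{C}_{\mathbb{Q}}(G,N)$, $4\,\mathrm{scl}_{G,N}(c)=\mathrm{fl}_{G,N}(c)$.
   Context: Chains: $\mathrm{C}_1(G;A)$ is the free $A$-module on $G$, $\mathrm{C}_2(G;A)$ the free $A$-module on $G\times G$, $\partial(g_1,g_2)=g_2-g_1g_2+g_1$. $\mathrm{C}'_2(G,N;A)$ is generated by pairs $(g_1,g_2)$ with $g_1\in N$ or $g_2\in N$; $\mathrm{B}'_1(G,N;A)=\partial\,\mathrm{C}'_2(G,N;A)$; $\mathcal{C}_A(G,N)=\mathrm{C}_1(N;A)\cap\mathrm{B}'_1(G,N;A)$. For $c\in\mathrm{B}'_1(G,N;\mathbb{R})$, $\|c\|'=\inf\{\|c'\|_1: c'\in\mathrm{C}'_2(G,N;\mathbb{R}),\ \partial c'=c\}$ where $\|\cdot\|_1$ is the $\ell^1$-norm with respect to the basis $G\times G$. Filling norm: for $c=x_1+\cdots+x_k-\check x_1-\cdots-\check x_l\in\mathcal{C}_{\mathbb{Z}}(G,N)$ ($x_i,\check x_j\in N$), $\mathrm{fl}_{G,N}(c)=\lim_{n\to\infty}\frac1n\|x_1^n+\cdots+x_k^n-\check x_1^n-\cdots-\check x_l^n\|'$; for rational $c$, $\mathrm{fl}_{G,N}(c)=\frac1m\mathrm{fl}_{G,N}(mc)$ with $mc$ integral. Mixed scl: $[G,N]$ is generated by $[g,x]=gxg^{-1}x^{-1}$ ($g\in G,x\in N$), $\mathrm{cl}_{G,N}$ the word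 length with respect to these generators. For $x_1,\dots,x_m\in N$ with $x_1\cdots x_m\in[G,N]$: $\mathrm{cl}_{G,N}(x_1+\cdots+x_m)=\inf_{g_i\in G}\mathrm{cl}_{G,N}(x_1g_1x_2g_1^{-1}\cdots g_{m-1}x_mg_{m-1}^{-1})$, $\mathrm{scl}_{G,N}(x_1+\cdots+x_m)=\lim_n\frac1n\mathrm{cl}_{G,N}(x_1^n+\cdots+x_m^n)$. For $c=x_1+\cdots+x_k-\check x_1-\cdots-\check x_l\in\mathcal{C}_{\mathbb{Z}}(G,N)$ (with $x_1\cdots x_k\check x_1^{-1}\cdots\check x_l^{-1}\in[G,N]$), $\mathrm{scl}_{G,N}(c)=\mathrm{scl}_{G,N}(x_1+\cdots+x_k+\check x_1^{-1}+\cdots+\check x_l^{-1})$; for rational $c$, $\mathrm{scl}_{G,N}(c)=\frac1m\mathrm{scl}_{G,N}(mc)$. *)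

theory Defs
  imports Complex_Main "HOL-Algebra.Coset" "HOL-Library.Multiset"
begin

definition supp :: "('b \<Rightarrow> 'r::zero) \<Rightarrow> 'b set" where
  "supp c = {x. c x \<noteq> 0}"

definition chains1 :: "'a set \<Rightarrow> ('a \<Rightarrow> 'r::zero) set" where
  "chains1 S = {c. finite (supp c) \<and> supp c \<subseteq> S}"

definition chains2' :: "('a, 'm) monoid_scheme \<Rightarrow> 'a set \<Rightarrow> ('a \<times> 'a \<Rightarrow> 'r::zero) set" where
  "chains2' G N = {c. finite (supp c) \<and>
      supp c \<subseteq> {(g1, g2). g1 \<in> carrier G \<and> g2 \<in> carrier G \<and> (g1 \<in> N \<or> g2 \<in> N)}}"

definition bdry :: "('a, 'm) monoid_scheme \<Rightarrow> ('a \<times> 'a \<Rightarrow> 'r::comm_ring_1) \<Rightarrow> ('a \<Rightarrow> 'r)" where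
  "bdry G c = (\<lambda>h. \<Sum>p\<in>supp c. c p *
      (of_bool (snd p = h) - of_bool (fst p \<otimes>\<^bsub>G\<^esub> snd p = h) + of_bool (fst p = h)))"

definition bdries1' :: "('a, 'm) monoid_scheme \<Rightarrow> 'a set \<Rightarrow> ('a \<Rightarrow> 'r::comm_ring_1) set" where
  "bdries1' G N = bdry G ` chains2' G N"

definition calC :: "('a, 'm) monoid_scheme \<Rightarrow> 'a set \<Rightarrow> ('a \<Rightarrow> 'r::comm_ring_1) set" where
  "calC G N = chains1 N \<inter> bdries1' G N"

definition norm1 :: "('a \<times> 'a \<Rightarrow> real) \<Rightarrow> real" where
  "norm1 c = (\<Sum>p\<in>supp c. \<bar>c p\<bar>)"

definition fnorm' :: "('a, 'm) monoid_scheme \<Rightarrow> 'a set \<Rightarrow> ('a \<Rightarrow> real) \<Rightarrow> real" where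
  "fnorm' G N c = Inf {norm1 c' | c'. c' \<in> chains2' G N \<and> bdry G c' = c}"

text \<open>The chain obtained from c = sum c(x) x by replacing each x by x^n
  (i.e. x_1^n + ... + x_k^n - xcheck_1^n - ... - xcheck_l^n), as a real chain.\<close>
definition powchain :: "('a, 'm) monoid_scheme \<Rightarrow> nat \<Rightarrow> ('a \<Rightarrow> int) \<Rightarrow> ('a \<Rightarrow> real)" where
  "powchain G n c = (\<lambda>y. \<Sum>x\<in>{x \<in> supp c. x [^]\<^bsub>G\<^esub> n = y}. real_of_int (c x))"

definition flZ :: "('a, 'm) monoid_scheme \<Rightarrow> 'a set \<Rightarrow> ('a \<Rightarrow> int) \<Rightarrow> real" where
  "flZ G N c = lim (\<lambda>n. fnorm' G N (powchain G n c) / real n)"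

definition denomC :: "('a, 'm) monoid_scheme \<Rightarrow> 'a set \<Rightarrow> ('a \<Rightarrow> rat) \<Rightarrow> nat" where
  "denomC G N c = (LEAST m::nat. 0 < m \<and>
      (\<exists>d \<in> (calC G N :: ('a \<Rightarrow> int) set). (\<lambda>x. of_nat m * c x) = (\<lambda>x. of_int (d x))))"

definition flQ :: "('a, 'm) monoid_scheme \<Rightarrow> 'a set \<Rightarrow> ('a \<Rightarrow> rat) \<Rightarrow> real" where
  "flQ G N c = (let m = denomC G N c in
      flZ G N (\<lambda>x. \<lfloor>of_nat m * c x\<rfloor>) / real m)"

definition mixed_comms :: "('a, 'm) monoid_scheme \<Rightarrow> 'a set \<Rightarrow> 'a set" where
  "mixed_comms G N = {g \<otimes>\<^bsub>G\<^esub> x \<otimes>\<^bsub>G\<^esub> inv\<^bsub>G\<^esub> g \<otimes>\<^bsub>G\<^esub> inv\<^bsub>G\<^esub> x | g x. g \<in> carrier G \<and> x \<in> N}"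

definition clGN :: "('a, 'm) monoid_scheme \<Rightarrow> 'a set \<Rightarrow> 'a \<Rightarrow> nat" where
  "clGN G N h = (LEAST k. \<exists>ws. length ws = k \<and>
      set ws \<subseteq> mixed_comms G N \<union> (\<lambda>s. inv\<^bsub>G\<^esub> s) ` mixed_comms G N \<and>
      foldr (\<otimes>\<^bsub>G\<^esub>) ws \<one>\<^bsub>G\<^esub> = h)"

definition conjprod :: "('a, 'm) monoid_scheme \<Rightarrow> 'a list \<Rightarrow> 'a list \<Rightarrow> 'a" where
  "conjprod G gs xs = foldr (\<lambda>(g, x) acc. g \<otimes>\<^bsub>G\<^esub> x \<otimes>\<^bsub>G\<^esub> inv\<^bsub>G\<^esub> g \<otimes>\<^bsub>G\<^esub> acc)
      (zip gs xs) \<one>\<^bsub>G\<^esub>"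

text \<open>cl_{G,N}(x_1 + ... + x_m) = inf over g_i of cl(x_1 g_1 x_2 g_1^-1 ... g_{m-1} x_m g_{m-1}^-1)\<close>
definition cl_list :: "('a, 'm) monoid_scheme \<Rightarrow> 'a set \<Rightarrow> 'a list \<Rightarrow> nat" where
  "cl_list G N xs = Inf {clGN G N (conjprod G (\<one>\<^bsub>G\<^esub> # gs) xs) | gs.
      length gs = length xs - 1 \<and> set gs \<subseteq> carrier G}"

definition scl_list :: "('a, 'm) monoid_scheme \<Rightarrow> 'a set \<Rightarrow> 'a list \<Rightarrow> real" where
  "scl_list G N xs = lim (\<lambda>n. real (cl_list G N (map (\<lambda>x. x [^]\<^bsub>G\<^esub> n) xs)) / real n)"

text \<open>For an integral chain c = x_1 + ... + x_k - xcheck_1 - ... - xcheck_l, the multiset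
  {x_1,...,x_k, xcheck_1^-1, ..., xcheck_l^-1}.\<close>
definition chain_mset :: "('a, 'm) monoid_scheme \<Rightarrow> ('a \<Rightarrow> int) \<Rightarrow> 'a multiset" where
  "chain_mset G c = (\<Sum>x\<in>supp c. if 0 < c x then replicate_mset (nat (c x)) x
                                   else replicate_mset (nat (- c x)) (inv\<^bsub>G\<^esub> x))"

definition sclZ :: "('a, 'm) monoid_scheme \<Rightarrow> 'a set \<Rightarrow> ('a \<Rightarrow> int) \<Rightarrow> real" where
  "sclZ G N c = scl_list G N (SOME xs. mset xs = chain_mset G c)"

definition sclQ :: "('a, 'm) monoid_scheme \<Rightarrow> 'a set \<Rightarrow> ('a \<Rightarrow> rat) \<Rightarrow> real" where
  "sclQ G N c = (let m = denomC G N c in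
      sclZ G N (\<lambda>x. \<lfloor>of_nat m * c x\<rfloor>) / real m)"

end

theory Submission
  imports Defs "HOL-Analysis.Kronecker_Approximation_Theorem"
begin

text \<open>
  An equation between a product of conjugates of \<open>x\<^sub>1\<^sup>n, \<dots>, x\<^sub>k\<^sup>n\<close> and a product of \<open>K\<close> mixed
  commutators unfolds into a filling of norm at most \<open>4 K + O(1)\<close>, since \<open>[g, x]\<close> has a filling of
  norm \<open>3\<close> and each multiplication costs one more simplex; hence \<open>fl \<le> 4 scl\<close>.

  Conversely, a real filling of \<open>x\<^sub>1\<^sup>n + \<dots> + x\<^sub>k\<^sup>n\<close> is replaced by an integral filling, with \<open>T\<close>
  simplices, of \<open>q\<close> times this chain. Its simplices are triangles, which are glued along edges to a
  surface; an Euler characteristic count bounds its genus, and with it the number of commutators, by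
  \<open>T/4 + O(q k)\<close>. Joining the \<open>q\<close> copies of each \<open>x\<^sub>i\<^sup>n\<close> to \<open>(x\<^sub>i\<^sup>n)\<^sup>q\<close> costs another \<open>O(q k)\<close>
  commutators, and the errors disappear after dividing by \<open>n q\<close>.
\<close>

subsection \<open>Products of conjugates as products of mixed commutators\<close>

lemma (in group) inv_cancel_left:
  "\<lbrakk>x \<in> carrier G; y \<in> carrier G\<rbrakk> \<Longrightarrow> inv x \<otimes> (x \<otimes> y) = y"
  "\<lbrakk>x \<in> carrier G; y \<in> carrier G\<rbrakk> \<Longrightarrow> x \<otimes> (inv x \<otimes> y) = y"
  by (simp_all flip: m_assoc)

lemmas (in group) word_simps = m_assoc inv_mult_group inv_cancel_left

lemma (in group) inv_nat_pow:
  "x \<in> carrier G \<Longrightarrow> inv x [^] (n::nat) = inv (x [^] n)"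
proof (induction n)
  case (Suc n)
  then have "inv x [^] Suc n = inv (x \<otimes> x [^] n)"
    by (simp add: inv_mult_group)
  also have "x \<otimes> x [^] n = x [^] Suc n"
    using Suc.prems by (rule nat_pow_Suc2[symmetric])
  finally show ?case .
qed simp

section \<open>Products of mixed commutators for a normal subgroup\<close>

locale mixed_scl = normal N G for N and G (structure)
begin

lemma N_carrier [simp]: "x \<in> N \<Longrightarrow> x \<in> carrier G"
  by (rule mem_carrier)

lemma N_conj [simp]: "\<lbrakk>x \<in> N; g \<in> carrier G\<rbrakk> \<Longrightarrow> g \<otimes> x \<otimes> inv g \<in> N"
  by (rule inv_op_closed2)

lemma N_conj' [simp]: "\<lbrakk>x \<in> N; g \<in> carrier G\<rbrakk> \<Longrightarrow> g \<otimes> (x \<otimes> inv g) \<in> N"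
  using N_conj[of x g] by (simp add: m_assoc)

lemma N_pow [simp]: "x \<in> N \<Longrightarrow> x [^] (n::nat) \<in> N"
  by (induction n) auto

lemma N_mult_iff:
  "\<lbrakk>x \<in> N; g \<in> carrier G\<rbrakk> \<Longrightarrow> x \<otimes> g \<in> N \<longleftrightarrow> g \<in> N"
  "\<lbrakk>x \<in> N; g \<in> carrier G\<rbrakk> \<Longrightarrow> g \<otimes> x \<in> N \<longleftrightarrow> g \<in> N"
proof -
  assume *: "x \<in> N" "g \<in> carrier G"
  show "x \<otimes> g \<in> N \<longleftrightarrow> g \<in> N"
    using * subgroup.m_closed[OF subgroup_axioms, of "inv x" "x \<otimes> g"] by (auto simp: word_simps)
  show "g \<otimes> x \<in> N \<longleftrightarrow> g \<in> N"
    using * subgroup.m_closed[OF subgroup_axioms, of "g \<otimes> x" "inv x"] by (auto simp: word_simps)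
qed

text \<open>Since \<open>[\<one>, \<one>] = \<one>\<close>, a product of \<open>n\<close> generators
  is also one of any larger number, so \<open>n\<close> acts as an upper bound. There is no
  constructor for inverses because these are again mixed commutators, by
  \<open>comm_prod_comm'\<close>.\<close>

inductive comm_prod :: "nat \<Rightarrow> 'a \<Rightarrow> bool" where
  comm_prod_0: "comm_prod 0 \<one>"
| comm_prod_Suc: "\<lbrakk>g \<in> carrier G; x \<in> N; comm_prod n h\<rbrakk>
    \<Longrightarrow> comm_prod (Suc n) (g \<otimes> x \<otimes> inv g \<otimes> inv x \<otimes> h)"

lemma comm_prod_N: "comm_prod n h \<Longrightarrow> h \<in> N"
  by (induction rule: comm_prod.induct) auto

lemma comm_prod_carrier [simp]: "comm_prod n h \<Longrightarrow> h \<in> carrier G"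
  using comm_prod_N by simp

lemma comm_prod_comm: "\<lbrakk>g \<in> carrier G; x \<in> N\<rbrakk> \<Longrightarrow> comm_prod 1 (g \<otimes> x \<otimes> inv g \<otimes> inv x)"
  using comm_prod_Suc[OF _ _ comm_prod_0, of g x] by simp

text \<open>The inverse \<open>[x, g]\<close> of \<open>[g, x]\<close> equals
  \<open>[inv g, g \<otimes> x \<otimes> inv g]\<close>, whose second entry lies in \<open>N\<close>
  by normality.\<close>

lemma comm_prod_comm':
  assumes "g \<in> carrier G" "x \<in> N"
  shows "comm_prod 1 (x \<otimes> g \<otimes> inv x \<otimes> inv g)"
  using comm_prod_comm[of "inv g" "g \<otimes> x \<otimes> inv g"] assms by (simp add: word_simps)

lemma comm_prod_mult: "\<lbrakk>comm_prod n a; comm_prod m b\<rbrakk> \<Longrightarrow> comm_prod (n + m) (a \<otimes> b)"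
proof (induction rule: comm_prod.induct)
  case (comm_prod_Suc g x n h)
  then show ?case
    using comm_prod.comm_prod_Suc[of g x "n + m" "h \<otimes> b"] by (simp add: word_simps)
qed simp

lemma comm_prod_Suc_mono: "comm_prod n h \<Longrightarrow> comm_prod (Suc n) h"
  using comm_prod_Suc[of \<one> \<one> n h] by simp

lemma comm_prod_mono: "\<lbrakk>comm_prod n h; n \<le> m\<rbrakk> \<Longrightarrow> comm_prod m h"
  by (rotate_tac, induction m rule: dec_induct) (auto intro: comm_prod_Suc_mono)

lemma comm_prod_conj:
  "\<lbrakk>comm_prod n h; c \<in> carrier G\<rbrakk> \<Longrightarrow> comm_prod n (c \<otimes> h \<otimes> inv c)"
proof (induction rule: comm_prod.induct)
  case comm_prod_0
  then show ?case by (simp add: comm_prod.comm_prod_0)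
next
  case (comm_prod_Suc g x n h)
  then show ?case
    using comm_prod.comm_prod_Suc[of "c \<otimes> g \<otimes> inv c" "c \<otimes> x \<otimes> inv c" n "c \<otimes> h \<otimes> inv c"]
    by (simp add: word_simps)
qed

lemma comm_prod_inv: "comm_prod n h \<Longrightarrow> comm_prod n (inv h)"
proof (induction rule: comm_prod.induct)
  case comm_prod_0
  then show ?case by (simp add: comm_prod.comm_prod_0)
next
  case (comm_prod_Suc g x n h)
  then show ?case
    using comm_prod_mult[OF comm_prod_Suc(4) comm_prod_comm'[of g x]] by (simp add: word_simps)
qed

section \<open>Products of conjugates\<close>

definition cprod :: "('a \<times> 'a) list \<Rightarrow> 'a" where
  "cprod L = foldr (\<lambda>(g, x) acc. g \<otimes> x \<otimes> inv g \<otimes> acc) L \<one>"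

definition conj_pairs :: "('a \<times> 'a) list \<Rightarrow> bool" where
  "conj_pairs L \<longleftrightarrow> set L \<subseteq> carrier G \<times> N"

lemma cprod_simps [simp]:
  "cprod [] = \<one>" "cprod (p # L) = fst p \<otimes> snd p \<otimes> inv (fst p) \<otimes> cprod L"
  by (simp_all add: cprod_def case_prod_beta)

lemma conj_pairs_simps [simp]:
  "conj_pairs []"
  "conj_pairs (p # L) \<longleftrightarrow> fst p \<in> carrier G \<and> snd p \<in> N \<and> conj_pairs L"
  "conj_pairs (L @ L') \<longleftrightarrow> conj_pairs L \<and> conj_pairs L'"
  by (cases p; auto simp: conj_pairs_def)+

lemma cprod_N: "conj_pairs L \<Longrightarrow> cprod L \<in> N"
  by (induction L) auto

lemma cprod_carrier [simp]: "conj_pairs L \<Longrightarrow> cprod L \<in> carrier G"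
  using cprod_N by simp

lemma cprod_append:
  "\<lbrakk>conj_pairs L; conj_pairs L'\<rbrakk> \<Longrightarrow> cprod (L @ L') = cprod L \<otimes> cprod L'"
  by (induction L) (simp_all add: m_assoc)

lemma cprod_conj:
  assumes "conj_pairs L" "c \<in> carrier G"
  shows "cprod (map (map_prod ((\<otimes>) c) id) L) = c \<otimes> cprod L \<otimes> inv c"
    and "conj_pairs (map (map_prod ((\<otimes>) c) id) L)"
  using assms by (induction L) (simp_all add: word_simps)

text \<open>Moving a factor to the front past a product \<open>A\<close> only multiplies its
  conjugator by \<open>A\<close>, and leaves the whole product unchanged.\<close>

lemma conj_pairs_split:
  assumes "conj_pairs L" "x \<in># mset (map snd L)"
  obtains g L' where "g \<in> carrier G" "conj_pairs L'" "x \<in> N"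
    "mset (map snd L) = add_mset x (mset (map snd L'))"
    "cprod L = g \<otimes> x \<otimes> inv g \<otimes> cprod L'"
proof -
  obtain h where "(h, x) \<in> set L" using assms(2) by auto
  then obtain A D where L: "L = A @ (h, x) # D" by (auto simp: in_set_conv_decomp)
  then have ok: "conj_pairs A" "conj_pairs D" "h \<in> carrier G" "x \<in> N"
    using assms(1) by auto
  show thesis
  proof (rule that[of "cprod A \<otimes> h" "A @ D"])
    show "cprod L = cprod A \<otimes> h \<otimes> x \<otimes> inv (cprod A \<otimes> h) \<otimes> cprod (A @ D)"
      using ok by (simp add: L cprod_append word_simps)
  qed (use ok L in auto)
qed

text \<open>The relation "\<open>cl\<close> of the formal sum \<open>M\<close> is at most
  \<open>n\<close>". A multiset suffices because reordering factors only changes conjugators, and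
  the existential form avoids the default values of \<open>LEAST\<close> and
  \<open>Inf\<close>.\<close>

definition cl_le :: "nat \<Rightarrow> 'a multiset \<Rightarrow> bool" where
  "cl_le n M \<longleftrightarrow> (\<exists>L. conj_pairs L \<and> mset (map snd L) = M \<and> comm_prod n (cprod L))"

lemma cl_le_N: "\<lbrakk>cl_le n M; x \<in># M\<rbrakk> \<Longrightarrow> x \<in> N"
  by (fastforce simp: cl_le_def conj_pairs_def)

lemma cl_leE_add_mset:
  assumes "cl_le n (add_mset x M)"
  obtains L where "x \<in> N" "conj_pairs L" "mset (map snd L) = M" "comm_prod n (x \<otimes> cprod L)"
proof -
  obtain L where L: "conj_pairs L" "mset (map snd L) = add_mset x M" "comm_prod n (cprod L)"
    using assms by (auto simp: cl_le_def)
  then obtain g L' where L': "g \<in> carrier G" "conj_pairs L'" "x \<in> N"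
    "mset (map snd L') = M" "cprod L = g \<otimes> x \<otimes> inv g \<otimes> cprod L'"
    by (auto elim!: conj_pairs_split[of L x])
  let ?L = "map (map_prod ((\<otimes>) (inv g)) id) L'"
  have "comm_prod n (inv g \<otimes> cprod L \<otimes> inv (inv g))"
    using L L' by (intro comm_prod_conj) auto
  also have "inv g \<otimes> cprod L \<otimes> inv (inv g) = x \<otimes> cprod ?L"
    using L' by (subst cprod_conj) (simp_all add: word_simps)
  finally show thesis
    using L' cprod_conj(2)[of L' "inv g"] by (intro that[of ?L]) (simp_all add: comp_def)
qed

lemma cl_leE_add_mset2:
  assumes "cl_le n (add_mset x (add_mset y M))"
  obtains h L where "x \<in> N" "y \<in> N" "h \<in> carrier G" "conj_pairs L" "mset (map snd L) = M"
    "comm_prod n (x \<otimes> h \<otimes> y \<otimes> inv h \<otimes> cprod L)"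
proof -
  obtain L where L: "x \<in> N" "conj_pairs L" "mset (map snd L) = add_mset y M"
    "comm_prod n (x \<otimes> cprod L)"
    using assms by (rule cl_leE_add_mset)
  then obtain h L' where "h \<in> carrier G" "conj_pairs L'" "y \<in> N"
    "mset (map snd L') = M" "cprod L = h \<otimes> y \<otimes> inv h \<otimes> cprod L'"
    by (auto elim!: conj_pairs_split[of L y])
  then show thesis using L by (intro that[of h L']) (simp_all add: m_assoc)
qed

lemma cl_le_add_msetI:
  assumes "x \<in> N" "g \<in> carrier G" "conj_pairs L" "comm_prod n (g \<otimes> x \<otimes> inv g \<otimes> cprod L)"
  shows "cl_le n (add_mset x (mset (map snd L)))"
  unfolding cl_le_def by (rule exI[of _ "(g, x) # L"]) (use assms in auto)

lemma cl_le_conj: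
  assumes "cl_le n (add_mset x M)" "g \<in> carrier G"
  shows "cl_le n (add_mset (g \<otimes> x \<otimes> inv g) M)"
proof -
  obtain L where L: "x \<in> N" "conj_pairs L" "mset (map snd L) = M" "comm_prod n (x \<otimes> cprod L)"
    using assms(1) by (rule cl_leE_add_mset)
  then show ?thesis
    using assms(2) cl_le_add_msetI[of "g \<otimes> x \<otimes> inv g" "inv g" L n] by (simp add: word_simps)
qed

lemma cl_le_rotate:
  assumes "cl_le n (add_mset (x \<otimes> y) M)" "x \<in> carrier G" "y \<in> carrier G"
  shows "cl_le n (add_mset (y \<otimes> x) M)"
  using cl_le_conj[OF assms(1), of y] assms by (simp add: word_simps)

text \<open>Cutting a factor in two is free: the two pieces stay adjacent, with trivial conjugators.
  Merging, in \<open>cl_le_join\<close>, costs one commutator.\<close>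

lemma cl_le_split:
  assumes "cl_le n (add_mset (x \<otimes> y) M)" "x \<in> N" "y \<in> N"
  shows "cl_le n (add_mset x (add_mset y M))"
proof -
  obtain L where L: "conj_pairs L" "mset (map snd L) = M" "comm_prod n (x \<otimes> y \<otimes> cprod L)"
    using assms(1) by (rule cl_leE_add_mset)
  then show ?thesis
    using assms cl_le_add_msetI[of x \<one> "(\<one>, y) # L" n] by (simp add: word_simps)
qed

lemma cl_le_split_conj:
  assumes "cl_le n (add_mset (g \<otimes> x \<otimes> inv g \<otimes> y) M)" "x \<in> N" "y \<in> N" "g \<in> carrier G"
  shows "cl_le n (add_mset x (add_mset y M))"
  using cl_le_conj[OF cl_le_split[OF assms(1)], of "inv g"] assms by (simp add: word_simps)

lemma cl_le_one: "cl_le n (add_mset \<one> M) \<Longrightarrow> cl_le n M"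
  by (erule cl_leE_add_mset) (auto simp: cl_le_def)

text \<open>The conjugator \<open>h\<close> in front of \<open>y\<close> is removed by inserting
  \<open>[h, inv y]\<close>. The insertion is written as multiplication on the right by a conjugate
  of this commutator.\<close>

lemma cl_le_join:
  assumes "cl_le n (add_mset x (add_mset y M))"
  shows "cl_le (Suc n) (add_mset (x \<otimes> y) M)"
proof -
  obtain h L where L: "x \<in> N" "y \<in> N" "h \<in> carrier G" "conj_pairs L" "mset (map snd L) = M"
    "comm_prod n (x \<otimes> h \<otimes> y \<otimes> inv h \<otimes> cprod L)"
    using assms by (rule cl_leE_add_mset2)
  have "comm_prod (n + 1) (x \<otimes> h \<otimes> y \<otimes> inv h \<otimes> cprod L
      \<otimes> (inv (cprod L) \<otimes> (h \<otimes> inv y \<otimes> inv h \<otimes> inv (inv y)) \<otimes> inv (inv (cprod L))))"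
    using L by (intro comm_prod_mult comm_prod_conj comm_prod_comm) auto
  also have "x \<otimes> h \<otimes> y \<otimes> inv h \<otimes> cprod L
      \<otimes> (inv (cprod L) \<otimes> (h \<otimes> inv y \<otimes> inv h \<otimes> inv (inv y)) \<otimes> inv (inv (cprod L)))
      = x \<otimes> y \<otimes> cprod L"
    using L by (simp add: word_simps)
  finally show ?thesis
    using L cl_le_add_msetI[of "x \<otimes> y" \<one> L "Suc n"] by (simp add: word_simps)
qed

lemma cl_le_empty: "cl_le 0 {#}"
  unfolding cl_le_def by (rule exI[of _ "[]"]) (simp add: comm_prod_0)

lemma cl_le_mono: "\<lbrakk>cl_le n M; n \<le> m\<rbrakk> \<Longrightarrow> cl_le m M"
  by (auto simp: cl_le_def intro: comm_prod_mono)

lemma cl_le_add: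
  assumes "cl_le n M" "cl_le m M'"
  shows "cl_le (n + m) (M + M')"
proof -
  obtain L L' where "conj_pairs L" "mset (map snd L) = M" "comm_prod n (cprod L)"
    "conj_pairs L'" "mset (map snd L') = M'" "comm_prod m (cprod L')"
    using assms by (auto simp: cl_le_def)
  then show ?thesis
    unfolding cl_le_def
    by (intro exI[of _ "L @ L'"]) (simp add: cprod_append comm_prod_mult)
qed

lemma cl_le_pair: "x \<in> N \<Longrightarrow> cl_le 0 {#x, inv x#}"
  using cl_le_add_msetI[of x \<one> "[(\<one>, inv x)]" 0] by (simp add: comm_prod_0)

end

subsection \<open>Gluing triangles\<close>

definition lflip :: "bool \<times> 'b \<Rightarrow> bool \<times> 'b" where
  "lflip l = (\<not> fst l, snd l)"

lemma lflip_simps [simp]: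
  "lflip (lflip l) = l" "snd (lflip l) = snd l" "lflip l \<noteq> l" "l \<noteq> lflip l"
  "lflip k = lflip l \<longleftrightarrow> k = l" "lflip (s, a) = (\<not> s, a)"
  by (auto simp: lflip_def prod_eq_iff)

definition balanced :: "(bool \<times> 'b) multiset \<Rightarrow> bool" where
  "balanced M \<longleftrightarrow> (\<forall>l. count M (lflip l) = count M l)"

lemma balanced_flip_in: "\<lbrakk>balanced M; l \<in># M\<rbrakk> \<Longrightarrow> lflip l \<in># M"
  by (metis balanced_def count_eq_zero_iff)

text \<open>Gluing two edges of opposite sign therefore preserves balance.\<close>

lemma balanced_cancel: "balanced (add_mset l (add_mset (lflip l) M)) \<longleftrightarrow> balanced M"
proof -
  have "count (add_mset l (add_mset (lflip l) M)) (lflip k) = count (add_mset l (add_mset (lflip l) M)) k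
      \<longleftrightarrow> count M (lflip k) = count M k" for k
  proof -
    have "lflip k = l \<longleftrightarrow> k = lflip l" by (auto simp: lflip_def prod_eq_iff)
    then show ?thesis
      using lflip_simps(3-5)[of l] by (cases "k = l"; cases "k = lflip l") auto
  qed
  then show ?thesis by (simp add: balanced_def)
qed

context mixed_scl
begin

section \<open>Words of signed edges\<close>

definition lval :: "bool \<times> 'a \<Rightarrow> 'a" where
  "lval l = (if fst l then snd l else inv (snd l))"

lemma lval_carrier [simp]: "snd l \<in> carrier G \<Longrightarrow> lval l \<in> carrier G"
  by (simp add: lval_def)

lemma lval_N_iff: "snd l \<in> carrier G \<Longrightarrow> lval l \<in> N \<longleftrightarrow> snd l \<in> N"
  using subgroup.m_inv_closed[OF subgroup_axioms, of "inv (snd l)"] by (auto simp: lval_def)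

lemma lval_N [simp]: "snd l \<in> N \<Longrightarrow> lval l \<in> N"
  by (simp add: lval_def)

lemma lval_lflip: "snd l \<in> carrier G \<Longrightarrow> lval (lflip l) = inv (lval l)"
  by (simp add: lval_def lflip_def)

fun wval :: "(bool \<times> 'a) list \<Rightarrow> 'a" where
  "wval [] = \<one>"
| "wval (l # w) = lval l \<otimes> wval w"

definition word_in :: "'a set \<Rightarrow> (bool \<times> 'a) list \<Rightarrow> bool" where
  "word_in S w \<longleftrightarrow> snd ` set w \<subseteq> S"

lemma word_in_simps [simp]:
  "word_in S []" "word_in S (l # w) \<longleftrightarrow> snd l \<in> S \<and> word_in S w"
  "word_in S (v @ w) \<longleftrightarrow> word_in S v \<and> word_in S w"
  by (auto simp: word_in_def)

lemma word_in_carrier: "word_in N w \<Longrightarrow> word_in (carrier G) w"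
  by (auto simp: word_in_def)

lemma wval_carrier [simp]: "word_in (carrier G) w \<Longrightarrow> wval w \<in> carrier G"
  by (induction w) auto

lemma wval_N [simp]: "word_in N w \<Longrightarrow> wval w \<in> N"
  by (induction w) auto

lemma wval_append:
  "\<lbrakk>word_in (carrier G) v; word_in (carrier G) w\<rbrakk> \<Longrightarrow> wval (v @ w) = wval v \<otimes> wval w"
  by (induction v) (simp_all add: m_assoc)

section \<open>Triangles and the gluing moves\<close>

fun edges :: "(bool \<times> 'a) \<times> (bool \<times> 'a) \<times> (bool \<times> 'a) \<Rightarrow> (bool \<times> 'a) multiset" where
  "edges (e, f, h) = {#e, f, h#}"

text \<open>The condition on \<open>N\<close> allows any of the three sides, unlike that in
  \<open>chains2'\<close>, so that it is invariant under rotation.\<close>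

fun triangle :: "(bool \<times> 'a) \<times> (bool \<times> 'a) \<times> (bool \<times> 'a) \<Rightarrow> bool" where
  "triangle (e, f, h) \<longleftrightarrow> snd e \<in> carrier G \<and> snd f \<in> carrier G \<and> snd h \<in> carrier G \<and>
     lval e \<otimes> lval f \<otimes> lval h = \<one> \<and> (snd e \<in> N \<or> snd f \<in> N \<or> snd h \<in> N)"

text \<open>Rotating the sides conjugates their product, which is trivial; so a triangle can be
  attached along any of its edges.\<close>

lemma triangle_rotate:
  assumes "triangle \<tau>" "l \<in># edges \<tau>"
  obtains e f where "edges \<tau> = {#l, e, f#}" "triangle (l, e, f)"
proof -
  obtain e f h where \<tau>: "\<tau> = (e, f, h)" by (cases \<tau>) 
  have rot: "triangle (b, c, a)" if "triangle (a, b, c)" for a b c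
  proof -
    have closed: "lval a \<in> carrier G" "lval b \<in> carrier G" "lval c \<in> carrier G"
      using that by auto
    then have "lval b \<otimes> lval c \<otimes> lval a
        = inv (lval a) \<otimes> (lval a \<otimes> lval b \<otimes> lval c) \<otimes> lval a"
      by (simp add: m_assoc inv_cancel_left)
    also have "\<dots> = \<one>" using that by simp
    finally show ?thesis using that by auto
  qed
  consider "l = e" | "l = f" | "l = h" using assms(2) \<tau> by auto
  then show thesis
  proof cases
    case 1 then show ?thesis using that[of f h] assms \<tau> by simp
  next
    case 2 then show ?thesis using that[of h e] rot[of e f h] assms \<tau> by simp
  next
    case 3 then show ?thesis using that[of e f] rot[OF rot[of e f h]] assms \<tau> by simp
  qed
qed

lemma triangle_lval_flip:
  assumes "triangle (lflip l, e, f)"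
  shows "lval l = lval e \<otimes> lval f"
proof -
  have "lval l = lval l \<otimes> (lval (lflip l) \<otimes> lval e \<otimes> lval f)"
    using assms by simp
  also have "\<dots> = lval e \<otimes> lval f"
    using assms by (simp add: lval_lflip word_simps)
  finally show ?thesis .
qed

abbreviation letters :: "(bool \<times> 'a) list multiset \<Rightarrow> (bool \<times> 'a) multiset" where
  "letters W \<equiv> \<Sum>\<^sub># (image_mset mset W)"

text \<open>\<open>R\<close> are the triangles not used so far and the words in \<open>W\<close> are read off the free boundary
  components of the surface glued so far, while \<open>Y\<close> is the part of the boundary that is never
  glued. The letter \<open>(s, a)\<close> stands for the edge \<open>a\<close> with sign \<open>s\<close>; balance means that every
  remaining edge has a partner of opposite sign.\<close>

definition glue_state where
  "glue_state Y n R W \<longleftrightarrow> (\<forall>\<tau>\<in>#R. triangle \<tau>) \<and>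
     balanced (letters W + \<Sum>\<^sub># (image_mset edges R)) \<and> cl_le n (image_mset wval W + Y)"

text \<open>Gluing two edges of one boundary component cuts it into two. The glued edge may lie
  outside \<open>N\<close>, since it only acts as a conjugator, and no commutator is spent.\<close>

lemma glue_split:
  assumes "glue_state Y n R (add_mset (l # u @ lflip l # v) W)"
    and "wval u \<in> N" "wval v \<in> N" "word_in (carrier G) (l # u @ v)"
  shows "glue_state Y n R (add_mset u (add_mset v W))"
proof -
  have "wval (l # u @ lflip l # v) = lval l \<otimes> wval u \<otimes> inv (lval l) \<otimes> wval v"
    using assms by (simp add: wval_append lval_lflip m_assoc)
  moreover have "balanced (add_mset l (add_mset (lflip l)
      (mset u + mset v + letters W + \<Sum>\<^sub># (image_mset edges R))))"
    using assms(1) by (simp add: glue_state_def ac_simps add_mset_commute[of l "lflip l"])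
  ultimately show ?thesis
    using assms cl_le_split_conj[of n "lval l" "wval u" "wval v" "image_mset wval W + Y"]
    by (simp add: glue_state_def balanced_cancel ac_simps)
qed

lemma glue_rotate:
  assumes "glue_state Y n R (add_mset (u @ v) W)" "word_in (carrier G) (u @ v)"
  shows "glue_state Y n R (add_mset (v @ u) W)"
  using assms cl_le_rotate[of n "wval u" "wval v" "image_mset wval W + Y"]
  by (simp add: glue_state_def wval_append ac_simps)

text \<open>After a rotation, the two components multiply to the conjugate of \<open>u @ v\<close>
  by \<open>l\<close>, so merging them costs just one commutator. Both components must have values
  in \<open>N\<close>.\<close>

lemma glue_join:
  assumes "glue_state Y n R (add_mset (l # u) (add_mset (lflip l # v) W))"
    and "word_in N (l # u @ v)"
  shows "glue_state Y (Suc n) R (add_mset (u @ v) W)"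
proof -
  have "glue_state Y n R (add_mset (v @ [lflip l]) (add_mset (l # u) W))"
    using assms glue_rotate[of Y n R "[lflip l]" v "add_mset (l # u) W"]
    by (simp add: add_mset_commute word_in_carrier)
  then have *: "glue_state Y n R (add_mset (l # u) (add_mset (v @ [lflip l]) W))"
    by (simp add: add_mset_commute)
  have in_carrier: "word_in (carrier G) u" "word_in (carrier G) v" "snd l \<in> carrier G"
    using assms(2) by (simp_all add: word_in_carrier)
  have "cl_le (Suc n) (add_mset (wval (l # u) \<otimes> wval (v @ [lflip l])) (image_mset wval W + Y))"
    using * by (intro cl_le_join) (simp add: glue_state_def)
  then have "cl_le (Suc n) (add_mset
      (inv (lval l) \<otimes> (wval (l # u) \<otimes> wval (v @ [lflip l])) \<otimes> inv (inv (lval l))) (image_mset wval W + Y))"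
    using in_carrier by (intro cl_le_conj) auto
  also have "inv (lval l) \<otimes> (wval (l # u) \<otimes> wval (v @ [lflip l])) \<otimes> inv (inv (lval l)) = wval (u @ v)"
    using in_carrier by (simp add: wval_append lval_lflip word_simps)
  finally have "cl_le (Suc n) (add_mset (wval (u @ v)) (image_mset wval W + Y))" .
  moreover have "balanced (add_mset l (add_mset (lflip l)
      (mset u + mset v + letters W + \<Sum>\<^sub># (image_mset edges R))))"
    using assms(1) by (simp add: glue_state_def ac_simps add_mset_commute[of l "lflip l"])
  ultimately show ?thesis
    using assms(1) by (simp add: glue_state_def balanced_cancel ac_simps)
qed

text \<open>The other two sides of the triangle multiply to the value of the edge that they replace,
  so the word keeps its value and no commutator is spent.\<close>

lemma glue_triangle:
  assumes "glue_state Y n (add_mset \<tau> R) (add_mset (l # u) W)" "lflip l \<in># edges \<tau>"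
    and "word_in (carrier G) u"
  obtains e f where "triangle (lflip l, e, f)" "glue_state Y n R (add_mset (e # f # u) W)"
proof -
  have "triangle \<tau>" using assms(1) by (simp add: glue_state_def)
  then obtain e f where ef: "edges \<tau> = {#lflip l, e, f#}" "triangle (lflip l, e, f)"
    using triangle_rotate assms(2) by metis
  have "wval (l # u) = wval (e # f # u)"
    using ef(2) assms(3) triangle_lval_flip[of l e f] by (simp add: m_assoc)
  moreover have "balanced (add_mset l (add_mset (lflip l)
      ({#e, f#} + mset u + letters W + \<Sum>\<^sub># (image_mset edges R))))"
    using assms(1) by (simp add: glue_state_def ac_simps ef add_mset_commute[of l "lflip l"])
  ultimately show thesis
    using that[of e f] ef assms(1) by (simp add: glue_state_def balanced_cancel ac_simps)
qed

lemma glue_empty: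
  assumes "glue_state Y n R W" "\<forall>w\<in>#W. w = []"
  shows "cl_le n Y"
proof -
  have "cl_le n (image_mset wval W + Y) \<Longrightarrow> \<forall>w\<in>#W. w = [] \<Longrightarrow> cl_le n Y"
    by (induction W) (auto dest: cl_le_one)
  then show ?thesis using assms unfolding glue_state_def by blast
qed

text \<open>Balance forces a partner of the first letter; the cases correspond to the moves
  \<open>glue_split\<close>, \<open>glue_join\<close> and \<open>glue_triangle\<close>.\<close>

lemma glue_partner:
  assumes "glue_state Y n R (add_mset (l # u) W)"
  obtains (same) p q where "u = p @ lflip l # q"
  | (other) p q W' where "W = add_mset (p @ lflip l # q) W'"
  | (tri) \<tau> R' where "R = add_mset \<tau> R'" "lflip l \<in># edges \<tau>"
proof -
  have "lflip l \<in># letters (add_mset (l # u) W) + \<Sum>\<^sub># (image_mset edges R)"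
    using assms by (intro balanced_flip_in) (auto simp: glue_state_def)
  then consider "lflip l \<in> set u" | w where "w \<in># W" "lflip l \<in> set w"
    | \<tau> where "\<tau> \<in># R" "lflip l \<in># edges \<tau>"
    using lflip_simps(3)[of l] by auto
  then show thesis
  proof cases
    case 1 then show ?thesis using same by (auto simp: in_set_conv_decomp)
  next
    case 2 then show ?thesis using other by (metis in_set_conv_decomp multi_member_split)
  next
    case 3 then show ?thesis using tri by (metis multi_member_split)
  qed
qed

text \<open>The quantity \<open>4 n + |R| + #letters + 2 #words\<close> does not increase in any step: attaching a
  triangle trades it for a letter, splitting a word removes two letters and adds a word, and joining
  two words removes two letters and a word at the price of one commutator. Edges outside \<open>N\<close> cannot
  be joined at this price. Since every triangle has no or two such edges, they come in strips, and
  a strip is completed before anything else is glued: at any time at most one word has edges \<open>h, f\<close>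
  outside \<open>N\<close>, and following \<open>h\<close> through the triangles ends with \<open>f = lflip h\<close>, where the word
  splits.\<close>

lemma glue:
  assumes "glue_state Y n R W"
    and "(\<forall>w\<in>#W. word_in N w) \<or> (\<exists>h f U X W'. W = add_mset (h # U @ f # X) W' \<and>
      snd h \<in> carrier G - N \<and> snd f \<in> carrier G - N \<and> word_in N U \<and> word_in N X \<and>
      (\<forall>w\<in>#W'. word_in N w))"
  shows "\<exists>m. cl_le m Y \<and> 4 * m \<le> 4 * n + size R + size (letters W) + 2 * size W"
  using assms
\<comment> \<open>Attaching a triangle lowers this measure by one, since it adds one letter; gluing
  two letters lowers it by two.\<close>
proof (induction "2 * size R + size (letters W)" arbitrary: n R W rule: less_induct)
  case less
  note IH = less.hyps
  show ?case
  proof (cases "\<forall>w\<in>#W. word_in N w")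
    case True
    note words = this
    show ?thesis
    proof (cases "\<forall>w\<in>#W. w = []")
      case True
      then show ?thesis using glue_empty[OF less.prems(1)] by auto
    next
      case False
      then obtain w where w: "w \<in># W" "w \<noteq> []" by auto
      then obtain l u W1 where W: "W = add_mset (l # u) W1"
        by (metis list.exhaust multi_member_split)
      then have lu: "snd l \<in> N" "word_in N u" "\<forall>w\<in>#W1. word_in N w"
        using words by auto
      note st = less.prems(1)[unfolded W]
      from st show ?thesis
      proof (cases rule: glue_partner)
        case (same p q)
        then have "glue_state Y n R (add_mset p (add_mset q W1))"
          using glue_split[of Y n R l p q W1] st lu by (auto simp: word_in_carrier)
        from IH[OF _ this] show ?thesis
          using same lu W by (auto simp: algebra_simps)
      next
        case (other p q W2)
        have pq: "word_in N p" "word_in N q" "\<forall>w\<in>#W2. word_in N w" using lu other by auto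
        have "glue_state Y n R (add_mset (p @ lflip l # q) (add_mset (l # u) W2))"
          using st by (simp add: other add_mset_commute)
        from glue_rotate[OF this] have "glue_state Y n R (add_mset ((lflip l # q) @ p) (add_mset (l # u) W2))"
          using lu pq by (auto simp: word_in_carrier)
        then have "glue_state Y (Suc n) R (add_mset (u @ (q @ p)) W2)"
          using glue_join[of Y n R l u "q @ p" W2] lu pq by (auto simp: add_mset_commute)
        from IH[OF _ this] show ?thesis
          using other lu pq W by (auto simp: algebra_simps)
      next
        case (tri \<tau> R')
        then obtain e f where ef: "triangle (lflip l, e, f)" "glue_state Y n R' (add_mset (e # f # u) W1)"
          using st lu by (auto elim!: glue_triangle[of Y n \<tau> R' l u W1] simp: word_in_carrier)
        \<comment> \<open>As \<open>l\<close> lies in \<open>N\<close>, so does the product of the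
          new sides; hence both of them or neither lie in \<open>N\<close>.\<close>
        have "lval l \<in> N \<longleftrightarrow> lval e \<otimes> lval f \<in> N"
          using triangle_lval_flip[OF ef(1)] by simp
        then have "snd e \<in> N \<longleftrightarrow> snd f \<in> N"
          using lu ef(1) N_mult_iff[of "lval e" "lval f"] N_mult_iff[of "lval f" "lval e"]
          by (auto simp: lval_N_iff)
        then consider "snd e \<in> N" "snd f \<in> N" | "snd e \<in> carrier G - N" "snd f \<in> carrier G - N"
          using ef(1) by auto
        then show ?thesis
        proof cases
          case 1
          from IH[OF _ ef(2)] show ?thesis
            using 1 lu tri W by (auto simp: algebra_simps)
        next
          case 2
          \<comment> \<open>Here a strip opens, with ends \<open>e\<close> and \<open>f\<close> and
            nothing between them.\<close>
          have "\<exists>m. cl_le m Y \<and> 4 * m \<le> 4 * n + size R' + size (letters (add_mset (e # f # u) W1))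
              + 2 * size (add_mset (e # f # u) W1)"
          proof (rule IH[OF _ ef(2)], goal_cases)
            case 1 then show ?case using tri W by simp
          next
            case 2
            show ?case
              by (rule disjI2, rule exI[of _ e], rule exI[of _ f], rule exI[of _ "[]"], rule exI[of _ u], rule exI[of _ W1])
                (use \<open>snd e \<in> carrier G - N\<close> \<open>snd f \<in> carrier G - N\<close> lu in auto)
          qed
          then show ?thesis using tri W by (auto simp: algebra_simps)
        qed
      qed
    qed
  next
    case False
    then obtain h f U X W' where W: "W = add_mset (h # U @ f # X) W'"
      and hf: "snd h \<in> carrier G" "snd h \<notin> N" "snd f \<in> carrier G" "snd f \<notin> N"
      and UX: "word_in N U" "word_in N X" "\<forall>w\<in>#W'. word_in N w"
      using less.prems(2) by auto
    note st = less.prems(1)[unfolded W]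
    show ?thesis
    proof (cases "f = lflip h")
      case True
      \<comment> \<open>The two ends of the strip meet, and gluing them leaves only words in
        \<open>N\<close>.\<close>
      have "glue_state Y n R (add_mset U (add_mset X W'))"
        using glue_split[of Y n R h U X W'] st hf UX by (simp add: True word_in_carrier)
      from IH[OF _ this] show ?thesis
        using True UX W by (auto simp: algebra_simps)
    next
      case False
      \<comment> \<open>The partner of \<open>h\<close> lies outside \<open>N\<close>. The other
        words have all letters in \<open>N\<close>, and in its own word only \<open>f\<close> could
        be the partner, so it belongs to a triangle not yet attached.\<close>
      have notN: "\<not> word_in N (p @ lflip h # q)" for p q
        using hf by simp
      from st show ?thesis
      proof (cases rule: glue_partner)
        case (same p q)
        have "lflip h \<in> set (U @ f # X)" unfolding same by simp
        then show ?thesis using False UX hf by (auto simp: word_in_def)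
      next
        case (other p q W2)
        then show ?thesis using UX notN by auto
      next
        case (tri \<tau> R')
        then obtain e1 e2 where e: "triangle (lflip h, e1, e2)"
          "glue_state Y n R' (add_mset (e1 # e2 # U @ f # X) W')"
          using st UX hf by (auto elim!: glue_triangle[of Y n \<tau> R' h "U @ f # X" W'] simp: word_in_carrier)
        have e_carrier: "snd e1 \<in> carrier G" "snd e2 \<in> carrier G" using e(1) by auto
        have "lval h \<in> N \<longleftrightarrow> lval e1 \<otimes> lval e2 \<in> N"
          using triangle_lval_flip[OF e(1)] by simp
        then have "\<not> (snd e1 \<in> N \<and> snd e2 \<in> N)"
          using hf by (auto simp: lval_N_iff)
        then consider "snd e1 \<in> N" "snd e2 \<in> carrier G - N" | "snd e1 \<in> carrier G - N" "snd e2 \<in> N"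
          using e(1) hf by auto
        then show ?thesis
        proof cases
          case 1
          \<comment> \<open>The strip continues with \<open>e2\<close>. The letter \<open>e1\<close>
            is rotated to the end of the word, so that the word again starts outside
            \<open>N\<close>.\<close>
          have "glue_state Y n R' (add_mset ((e2 # U @ f # X) @ [e1]) W')"
            by (rule glue_rotate) (use e(2) e_carrier hf UX in \<open>auto simp: word_in_carrier\<close>)
          then have "glue_state Y n R' (add_mset (e2 # U @ f # (X @ [e1])) W')" by simp
          then have "\<exists>m. cl_le m Y \<and> 4 * m \<le> 4 * n + size R'
              + size (letters (add_mset (e2 # U @ f # (X @ [e1])) W'))
              + 2 * size (add_mset (e2 # U @ f # (X @ [e1])) W')"
          proof (rule IH[rotated], goal_cases)
            case 1
            show ?case
              by (rule disjI2, rule exI[of _ e2], rule exI[of _ f], rule exI[of _ U],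
                  rule exI[of _ "X @ [e1]"], rule exI[of _ W'])
                (use \<open>snd e1 \<in> N\<close> \<open>snd e2 \<in> carrier G - N\<close> UX hf in auto)
          next
            case 2 then show ?case using tri W by simp
          qed
          then show ?thesis using tri W by (auto simp: algebra_simps)
        next
          case 2
          have "\<exists>m. cl_le m Y \<and> 4 * m \<le> 4 * n + size R'
              + size (letters (add_mset (e1 # (e2 # U) @ f # X) W'))
              + 2 * size (add_mset (e1 # (e2 # U) @ f # X) W')"
            using e(2)[folded append_Cons[of e2 U "f # X"]]
          proof (rule IH[rotated], goal_cases)
            case 1
            show ?case
              by (rule disjI2, rule exI[of _ e1], rule exI[of _ f], rule exI[of _ "e2 # U"],
                  rule exI[of _ X], rule exI[of _ W'])
                (use \<open>snd e2 \<in> N\<close> \<open>snd e1 \<in> carrier G - N\<close> UX hf in auto)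
          next
            case 2 then show ?case using tri W by simp
          qed
          then show ?thesis using tri W by (auto simp: algebra_simps)
        qed
      qed
    qed
  qed
qed

end

subsection \<open>Mixed commutator lengths of powers\<close>

context mixed_scl
begin

section \<open>Comparison with \<open>clGN\<close> and \<open>cl_list\<close>\<close>

lemma inv_mixed_comms: "h \<in> mixed_comms G N \<Longrightarrow> inv h \<in> mixed_comms G N"
proof -
  assume "h \<in> mixed_comms G N"
  then obtain g x where h: "h = g \<otimes> x \<otimes> inv g \<otimes> inv x" "g \<in> carrier G" "x \<in> N"
    by (auto simp: mixed_comms_def)
  let ?y = "g \<otimes> x \<otimes> inv g"
  have "inv h = inv g \<otimes> ?y \<otimes> inv (inv g) \<otimes> inv ?y"
    using h by (simp add: word_simps)
  moreover have "inv g \<in> carrier G" "?y \<in> N" using h by simp_all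
  ultimately show ?thesis unfolding mixed_comms_def by blast
qed

lemma comm_prod_iff:
  "comm_prod k h \<longleftrightarrow> (\<exists>ws. length ws = k \<and>
     set ws \<subseteq> mixed_comms G N \<union> (\<lambda>s. inv s) ` mixed_comms G N \<and> foldr (\<otimes>) ws \<one> = h)"
proof
  assume "comm_prod k h"
  then show "\<exists>ws. length ws = k \<and>
     set ws \<subseteq> mixed_comms G N \<union> (\<lambda>s. inv s) ` mixed_comms G N \<and> foldr (\<otimes>) ws \<one> = h"
  proof (induction rule: comm_prod.induct)
    case (comm_prod_Suc g x n h)
    then obtain ws where "length ws = n"
      "set ws \<subseteq> mixed_comms G N \<union> (\<lambda>s. inv s) ` mixed_comms G N" "foldr (\<otimes>) ws \<one> = h"
      by blast
    moreover have "g \<otimes> x \<otimes> inv g \<otimes> inv x \<in> mixed_comms G N"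
      using comm_prod_Suc by (auto simp: mixed_comms_def)
    ultimately show ?case
      by (intro exI[of _ "g \<otimes> x \<otimes> inv g \<otimes> inv x # ws"]) auto
  qed auto
next
  have "comm_prod (length ws) (foldr (\<otimes>) ws \<one>)" if "set ws \<subseteq> mixed_comms G N" for ws
    using that
  proof (induction ws)
    case (Cons w ws)
    then obtain g x where "w = g \<otimes> x \<otimes> inv g \<otimes> inv x" "g \<in> carrier G" "x \<in> N"
      by (auto simp: mixed_comms_def)
    then show ?case using Cons comm_prod_Suc[of g x] by simp
  qed (simp add: comm_prod_0)
  moreover have "mixed_comms G N \<union> (\<lambda>s. inv s) ` mixed_comms G N = mixed_comms G N"
    using inv_mixed_comms by auto
  ultimately show "\<exists>ws. length ws = k \<and>
     set ws \<subseteq> mixed_comms G N \<union> (\<lambda>s. inv s) ` mixed_comms G N \<and> foldr (\<otimes>) ws \<one> = h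
     \<Longrightarrow> comm_prod k h"
    by auto
qed

lemma clGN_eq: "clGN G N h = (LEAST k. comm_prod k h)"
  unfolding clGN_def comm_prod_iff ..

lemma conjprod_eq: "conjprod G gs xs = cprod (zip gs xs)"
  unfolding conjprod_def cprod_def ..

lemma conj_pairs_zip: "\<lbrakk>set gs \<subseteq> carrier G; set xs \<subseteq> N\<rbrakk> \<Longrightarrow> conj_pairs (zip gs xs)"
  unfolding conj_pairs_def by (auto dest: set_zip_leftD set_zip_rightD)

lemma cprod_reorder:
  assumes "conj_pairs L" "mset (map snd L) = mset xs"
  shows "\<exists>gs. length gs = length xs \<and> set gs \<subseteq> carrier G \<and> cprod (zip gs xs) = cprod L"
  using assms
proof (induction xs arbitrary: L)
  case (Cons x xs)
  then obtain g L' where L': "g \<in> carrier G" "conj_pairs L'" "x \<in> N"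
    "mset (map snd L) = add_mset x (mset (map snd L'))"
    "cprod L = g \<otimes> x \<otimes> inv g \<otimes> cprod L'"
    by (elim conj_pairs_split[of L x]) auto
  then obtain gs where "length gs = length xs" "set gs \<subseteq> carrier G" "cprod (zip gs xs) = cprod L'"
    using Cons.IH[of L'] Cons.prems(2) by auto
  then show ?case using L' by (intro exI[of _ "g # gs"]) auto
qed auto

text \<open>By the next lemma, either all or none of the products in \<open>cl_list\<close> lie in \<open>[G, N]\<close>; in the relevant case
  \<open>clGN\<close> is never the \<open>LEAST\<close> of an empty predicate.\<close>

lemma cprod_zip_commutators:
  assumes "length gs = length xs" "set gs \<subseteq> carrier G" "set xs \<subseteq> N"
  shows "\<exists>k. comm_prod k (cprod (zip gs xs) \<otimes> inv (foldr (\<otimes>) xs \<one>))"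
  using assms
proof (induction gs xs rule: list_induct2)
  case Nil
  then show ?case using comm_prod_0 by auto
next
  case (Cons g gs x xs)
  then obtain k where k: "comm_prod k (cprod (zip gs xs) \<otimes> inv (foldr (\<otimes>) xs \<one>))" by auto
  have xs: "foldr (\<otimes>) xs \<one> \<in> carrier G"
    using Cons.prems(2) by (induction xs) auto
  have gx: "g \<in> carrier G" "x \<in> N" "conj_pairs (zip gs xs)"
    using Cons.prems by (auto intro: conj_pairs_zip)
  \<comment> \<open>The factor \<open>g \<otimes> x \<otimes> inv g\<close> is exchanged for
    \<open>x\<close> by \<open>[g, x]\<close>; the remaining quotient is then conjugated by
    \<open>x\<close>.\<close>
  have "comm_prod (1 + k) ((g \<otimes> x \<otimes> inv g \<otimes> inv x) \<otimes>
      (x \<otimes> (cprod (zip gs xs) \<otimes> inv (foldr (\<otimes>) xs \<one>)) \<otimes> inv x))"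
    using k gx by (intro comm_prod_mult comm_prod_comm comm_prod_conj) auto
  then have "comm_prod (1 + k) (cprod (zip (g # gs) (x # xs)) \<otimes> inv (foldr (\<otimes>) (x # xs) \<one>))"
    using gx xs by (simp add: word_simps)
  then show ?case ..
qed

text \<open>The first conjugator, which \<open>cl_list\<close> fixes to be \<open>\<one>\<close>, is
  removed by conjugating the whole product.\<close>

lemma cl_le_obtain_list:
  assumes "cl_le n (mset xs)"
  obtains gs where "length gs = length xs - 1" "set gs \<subseteq> carrier G"
    "comm_prod n (conjprod G (\<one> # gs) xs)"
proof (cases xs)
  case Nil
  have "comm_prod n \<one>" using comm_prod_mono[OF comm_prod_0] by simp
  then show ?thesis using that[of "[]"] Nil by (simp add: conjprod_eq)
next
  case (Cons x ys)
  then obtain L where L: "x \<in> N" "conj_pairs L" "mset (map snd L) = mset ys" "comm_prod n (x \<otimes> cprod L)"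
    using assms by (auto elim: cl_leE_add_mset)
  then obtain gs where "length gs = length ys" "set gs \<subseteq> carrier G" "cprod (zip gs ys) = cprod L"
    using cprod_reorder by blast
  then show ?thesis using L that[of gs] Cons by (simp add: conjprod_eq)
qed

text \<open>Under the assumption, \<open>cl_list\<close> is the least \<open>n\<close> with
  \<open>cl_le n\<close>. For the second claim, the product attaining the infimum must itself be a
  product of mixed commutators, so that its \<open>clGN\<close> is a genuine length.\<close>

lemma
  assumes "cl_le n (mset xs)"
  shows cl_list_le: "cl_list G N xs \<le> n"
    and cl_le_cl_list: "cl_le (cl_list G N xs) (mset xs)"
proof -
  let ?S = "{clGN G N (conjprod G (\<one> # gs) xs) | gs. length gs = length xs - 1 \<and> set gs \<subseteq> carrier G}"
  obtain gs where gs: "length gs = length xs - 1" "set gs \<subseteq> carrier G"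
    "comm_prod n (conjprod G (\<one> # gs) xs)"
    using assms by (rule cl_le_obtain_list)
  have mem: "clGN G N (conjprod G (\<one> # gs) xs) \<in> ?S"
    using gs by blast
  then have "cl_list G N xs \<le> clGN G N (conjprod G (\<one> # gs) xs)"
    unfolding cl_list_def by (intro cInf_lower) auto
  also have "\<dots> \<le> n" unfolding clGN_eq by (rule Least_le) (rule gs)
  finally show "cl_list G N xs \<le> n" .
  have xs: "set xs \<subseteq> N"
    using cl_le_N[OF assms] by auto
  show "cl_le (cl_list G N xs) (mset xs)"
  proof (cases xs)
    case Nil
    then show ?thesis using cl_le_mono[OF cl_le_empty] by simp
  next
    case (Cons x ys)
    have "cl_list G N xs \<in> ?S"
      unfolding cl_list_def using mem by (intro Inf_nat_def1) blast
    then obtain hs where hs: "length hs = length xs - 1" "set hs \<subseteq> carrier G"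
      "cl_list G N xs = clGN G N (conjprod G (\<one> # hs) xs)"
      by auto
    define P where "P = conjprod G (\<one> # gs) xs"
    define P' where "P' = conjprod G (\<one> # hs) xs"
    define f where "f = foldr (\<otimes>) xs \<one>"
    have carrier: "P \<in> carrier G" "P' \<in> carrier G" 
      unfolding P_def P'_def conjprod_eq using gs hs xs by (auto intro!: cprod_carrier conj_pairs_zip)
    have f: "f \<in> carrier G" unfolding f_def using xs by (induction xs) auto
    obtain k k' where "comm_prod k (P \<otimes> inv f)" "comm_prod k' (P' \<otimes> inv f)"
      unfolding P_def P'_def f_def conjprod_eq
      using cprod_zip_commutators[of "\<one> # gs" xs] cprod_zip_commutators[of "\<one> # hs" xs]
        gs hs xs Cons by auto
    \<comment> \<open>\<open>P\<close> and \<open>P'\<close> both agree with \<open>f\<close> modulo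
      mixed commutators, so \<open>P'\<close> inherits a commutator expression from
      \<open>P\<close>.\<close>
    then have "comm_prod (k' + k + n) ((P' \<otimes> inv f) \<otimes> inv (P \<otimes> inv f) \<otimes> P)"
      using gs(3) unfolding P_def[symmetric] by (intro comm_prod_mult comm_prod_inv)
    also have "(P' \<otimes> inv f) \<otimes> inv (P \<otimes> inv f) \<otimes> P = P'"
      using carrier f by (simp add: word_simps)
    finally have "comm_prod (clGN G N P') P'"
      unfolding clGN_eq by (rule LeastI)
    then show ?thesis
      unfolding cl_le_def hs(3) P'_def[symmetric]
      using hs xs Cons by (intro exI[of _ "zip (\<one> # hs) xs"])
        (auto simp: P'_def conjprod_eq intro!: conj_pairs_zip)
  qed
qed

lemma cl_le_join_many:
  assumes "cl_le n (image_mset f M + image_mset g M + Z)"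
  shows "cl_le (n + size M) (image_mset (\<lambda>x. f x \<otimes> g x) M + Z)"
  using assms
proof (induction M arbitrary: n Z)
  case (add x M)
  have "cl_le n (add_mset (f x) (add_mset (g x) (image_mset f M + image_mset g M + Z)))"
    using add.prems by (simp add: add_mset_commute)
  then have "cl_le (Suc n) (image_mset f M + image_mset g M + add_mset (f x \<otimes> g x) Z)"
    by (auto dest!: cl_le_join)
  from add.IH[OF this] show ?case by simp
qed simp

section \<open>Powers of the boundary elements\<close>

abbreviation pow_mset :: "nat \<Rightarrow> 'a multiset \<Rightarrow> 'a multiset" where
  "pow_mset n M \<equiv> image_mset (\<lambda>x. x [^] n) M"

lemma cl_le_pow_join:
  assumes "set_mset M \<subseteq> N" "cl_le n (pow_mset i M + pow_mset j M + Z)"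
  shows "cl_le (n + size M) (pow_mset (i + j) M + Z)"
proof -
  have "image_mset (\<lambda>x. x [^] i \<otimes> x [^] j) M = pow_mset (i + j) M"
    using assms(1) by (intro image_mset_cong) (auto simp: nat_pow_mult)
  then show ?thesis using cl_le_join_many[OF assms(2)] by simp
qed

text \<open>Joining \<open>x [^] i\<close> to \<open>x [^] j\<close> for each element of
  \<open>M\<close> gives subadditivity in the exponent up to a constant, as \<open>fekete\<close>
  requires.\<close>

lemma cl_le_pow_add:
  assumes "set_mset M \<subseteq> N" "cl_le n (pow_mset i M)" "cl_le m (pow_mset j M)"
  shows "cl_le (n + m + size M) (pow_mset (i + j) M)"
  using cl_le_pow_join[OF assms(1), of "n + m" i j "{#}"] cl_le_add[OF assms(2,3)] by simp

lemma cl_le_pow_mult: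
  assumes "set_mset M \<subseteq> N" "cl_le n (repeat_mset q (pow_mset i M))" "0 < q"
  shows "cl_le (n + q * size M) (pow_mset (i * q) M)"
proof -
  \<comment> \<open>The exponent \<open>j\<close> collects the copies joined so far. The claim is
    then applied with the first copy as start, \<open>j = i\<close>, and the \<open>p\<close>
    remaining ones.\<close>
  have "cl_le (n + q * size M) (pow_mset (j + i * q) M)"
    if "cl_le n (repeat_mset q (pow_mset i M) + pow_mset j M)" for n q j
    using that
  proof (induction q arbitrary: n j)
    case (Suc q)
    then have "cl_le n (pow_mset i M + pow_mset j M + repeat_mset q (pow_mset i M))"
      by (simp add: ac_simps)
    from cl_le_pow_join[OF assms(1) this]
    have "cl_le (n + size M) (repeat_mset q (pow_mset i M) + pow_mset (j + i) M)"
      by (simp add: ac_simps)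
    from Suc.IH[OF this] show ?case by (simp add: algebra_simps)
  qed simp
  note * = this
  obtain p where q: "q = Suc p" using assms(3) gr0_implies_Suc by blast
  then have "cl_le (n + p * size M) (pow_mset (i + i * p) M)"
    using assms(2) by (intro *) (simp add: ac_simps)
  then show ?thesis
    using cl_le_mono[of "n + p * size M" "pow_mset (i * q) M" "n + q * size M"] by (simp add: q)
qed

end

subsection \<open>Integral fillings from real fillings\<close>

definition signed_mset :: "('b \<Rightarrow> int) \<Rightarrow> (bool \<times> 'b) multiset" where
  "signed_mset z = (\<Sum>x\<in>supp z. replicate_mset (nat \<bar>z x\<bar>) (0 < z x, x))"

definition chain_of :: "(bool \<times> 'b) multiset \<Rightarrow> 'b \<Rightarrow> int" where
  "chain_of M x = int (count M (True, x)) - int (count M (False, x))"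

lemma chain_of_simps [simp]:
  "chain_of {#} x = 0"
  "chain_of (add_mset l M) x = (if fst l then 1 else -1) * of_bool (snd l = x) + chain_of M x"
  "chain_of (M + M') x = chain_of M x + chain_of M' x"
  by (cases l; auto simp: chain_of_def)+

lemma chain_of_sum_mset: "chain_of (\<Sum>\<^sub># M) x = (\<Sum>A\<in>#M. chain_of A x)"
  by (induction M) auto

lemma chain_of_repeat: "chain_of (repeat_mset q M) x = int q * chain_of M x"
  by (simp add: chain_of_def algebra_simps)

lemma chain_of_eq_sum: "chain_of M x = (\<Sum>l\<in>#M. (if fst l then 1 else -1) * of_bool (snd l = x))"
  by (induction M) auto

text \<open>The algebraic boundary condition on a filling thus becomes the existence of gluing
  partners.\<close>

lemma balanced_iff_chain_of: "balanced M \<longleftrightarrow> (\<forall>x. chain_of M x = 0)"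
proof -
  have "count M (lflip (s, x)) = count M (s, x) \<longleftrightarrow> chain_of M x = 0" for s x
    by (cases s) (auto simp: chain_of_def)
  then show ?thesis by (auto simp: balanced_def)
qed

lemma sum_signed_mset:
  fixes f :: "bool \<times> 'b \<Rightarrow> 'c::comm_semiring_1"
  assumes "finite (supp z)"
  shows "(\<Sum>l\<in>#signed_mset z. f l) = (\<Sum>x\<in>supp z. of_nat (nat \<bar>z x\<bar>) * f (0 < z x, x))"
proof -
  have rep: "(\<Sum>l\<in>#replicate_mset n a. f l) = of_nat n * f a" for n a
    by simp
  have "(\<Sum>l\<in>#signed_mset z. f l) = (\<Sum>x\<in>supp z. \<Sum>l\<in>#replicate_mset (nat \<bar>z x\<bar>) (0 < z x, x). f l)"
    unfolding signed_mset_def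
    by (induction rule: infinite_finite_induct) (simp_all del: image_replicate_mset)
  then show ?thesis unfolding rep .
qed

lemma size_signed_mset: "finite (supp z) \<Longrightarrow> size (signed_mset z) = (\<Sum>x\<in>supp z. nat \<bar>z x\<bar>)"
  unfolding size_eq_sum_mset sum_signed_mset by simp

lemma chain_of_image_signed_mset:
  assumes "finite (supp z)"
  shows "chain_of (image_mset (map_prod id f) (signed_mset z)) y = (\<Sum>x\<in>supp z. z x * of_bool (f x = y))"
proof -
  have "chain_of (image_mset (map_prod id f) (signed_mset z)) y
      = (\<Sum>x\<in>supp z. of_nat (nat \<bar>z x\<bar>) * ((if 0 < z x then 1 else -1) * of_bool (f x = y)))"
    unfolding chain_of_eq_sum image_mset.compositionality comp_def sum_signed_mset[OF assms]
    by simp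
  also have "\<dots> = (\<Sum>x\<in>supp z. z x * of_bool (f x = y))"
    by (rule sum.cong) auto
  finally show ?thesis .
qed

lemma signed_msetD: "l \<in># signed_mset z \<Longrightarrow> snd l \<in> supp z"
  unfolding signed_mset_def
  by (induction rule: infinite_finite_induct[of _ "supp z"]) (auto simp: in_replicate_mset split: if_splits)

lemma bdry_superset:
  assumes "finite S" "supp c \<subseteq> S"
  shows "bdry G c h = (\<Sum>p\<in>S. c p *
      (of_bool (snd p = h) - of_bool (fst p \<otimes>\<^bsub>G\<^esub> snd p = h) + of_bool (fst p = h)))"
  unfolding bdry_def by (rule sum.mono_neutral_left) (use assms in \<open>auto simp: supp_def\<close>)

section \<open>The triangles of an integral filling\<close>

context mixed_scl
begin

text \<open>A negative simplex is the same triangle traversed backwards, so all its signs are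
  reversed and the product of the sides stays trivial.\<close>

fun tri_of :: "bool \<times> 'a \<times> 'a \<Rightarrow> (bool \<times> 'a) \<times> (bool \<times> 'a) \<times> (bool \<times> 'a)" where
  "tri_of (True, a, b) = ((True, a), (True, b), (False, a \<otimes> b))"
| "tri_of (False, a, b) = ((True, a \<otimes> b), (False, b), (False, a))"

lemma triangle_tri_of:
  assumes "a \<in> carrier G" "b \<in> carrier G" "a \<in> N \<or> b \<in> N"
  shows "triangle (tri_of (s, a, b))"
  using assms by (cases s) (auto simp: lval_def word_simps)

lemma chain_of_edges_tri_of:
  "chain_of (edges (tri_of l)) h = (if fst l then 1 else -1) *
     (of_bool (snd (snd l) = h) - of_bool (fst (snd l) \<otimes> snd (snd l) = h) + of_bool (fst (snd l) = h))"
  by (cases l rule: tri_of.cases) auto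

lemma chain_of_boundary:
  assumes "finite (supp z)"
  shows "chain_of (\<Sum>\<^sub># (image_mset edges (image_mset tri_of (signed_mset z)))) h = bdry G z h"
  unfolding chain_of_sum_mset image_mset.compositionality comp_def chain_of_edges_tri_of
    sum_signed_mset[OF assms] bdry_def
  by (rule sum.cong) auto

text \<open>The gluing starts from an annulus for each boundary edge \<open>l\<close>: one side stays in the boundary,
  the other one is the word \<open>[lflip l]\<close>.\<close>

lemma cl_le_of_integral_filling:
  fixes z :: "'a \<times> 'a \<Rightarrow> int"
  assumes "z \<in> chains2' G N" and "snd ` set_mset S \<subseteq> N" and "\<And>x. bdry G z x = chain_of S x"
  shows "\<exists>m. cl_le m (image_mset lval S) \<and> 4 * m \<le> size (signed_mset z) + 3 * size S"
proof -
  define R where "R = image_mset tri_of (signed_mset z)"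
  define W where "W = image_mset (\<lambda>l. [lflip l]) S"
  have z: "finite (supp z)" "supp z \<subseteq> {(g1, g2). g1 \<in> carrier G \<and> g2 \<in> carrier G \<and> (g1 \<in> N \<or> g2 \<in> N)}"
    using assms(1) by (auto simp: chains2'_def)
  have tri: "\<forall>\<tau>\<in>#R. triangle \<tau>"
  proof
    fix \<tau> assume "\<tau> \<in># R"
    then obtain s a b where "\<tau> = tri_of (s, a, b)" "(s, a, b) \<in># signed_mset z"
      by (auto simp: R_def)
    then show "triangle \<tau>" using signed_msetD[of "(s, a, b)" z] z(2) by (auto intro!: triangle_tri_of)
  qed
  have letters_W: "letters W = image_mset lflip S"
    unfolding W_def by (induction S) auto
  have "chain_of (image_mset lflip S) x = - chain_of S x" for x
    by (induction S) (auto simp: lflip_def)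
  then have bal: "balanced (letters W + \<Sum>\<^sub># (image_mset edges R))"
    unfolding balanced_iff_chain_of letters_W R_def
    by (simp add: chain_of_boundary[OF z(1)] assms(3))
  have cl0: "cl_le 0 (image_mset wval W + image_mset lval S)"
    unfolding W_def using assms(2)
  proof (induction S)
    case empty
    then show ?case by (simp add: cl_le_empty)
  next
    case (add l S)
    then have "cl_le (0 + 0) ({#lval l, inv (lval l)#} +
        (image_mset wval (image_mset (\<lambda>l. [lflip l]) S) + image_mset lval S))"
      by (intro cl_le_add cl_le_pair) auto
    then show ?case using add.prems by (simp add: lval_lflip ac_simps add_mset_commute)
  qed
  have "\<exists>m. cl_le m (image_mset lval S) \<and> 4 * m \<le> 4 * 0 + size R + size (letters W) + 2 * size W"
  proof (rule glue)
    show "glue_state (image_mset lval S) 0 R W"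
      unfolding glue_state_def using tri bal cl0 by blast
    show "(\<forall>w\<in>#W. word_in N w) \<or> (\<exists>h f U X W'. W = add_mset (h # U @ f # X) W' \<and>
      snd h \<in> carrier G - N \<and> snd f \<in> carrier G - N \<and> word_in N U \<and> word_in N X \<and>
      (\<forall>w\<in>#W'. word_in N w))"
      using assms(2) by (auto simp: W_def)
  qed
  \<comment> \<open>Each annulus contributes one letter and one word, hence \<open>1 + 2 = 3\<close>
    to the bound.\<close>
  moreover have "size (letters W) = size S" "size W = size S" "size R = size (signed_mset z)"
    unfolding letters_W by (simp_all add: W_def R_def)
  ultimately show ?thesis by (simp add: add.commute)
qed

end

text \<open>Simultaneous Diophantine approximation replaces a real filling by an integral one: a
  boundary with integer coefficients cannot move when the filling moves by little.\<close>

lemma integral_filling_approx: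
  fixes c :: "'a \<times> 'a \<Rightarrow> real" and b :: "'a \<Rightarrow> int"
  assumes "c \<in> chains2' G N" and "bdry G c = (\<lambda>x. of_int (b x))"
  obtains q :: nat and z :: "'a \<times> 'a \<Rightarrow> int"
  where "0 < q" "z \<in> chains2' G N" "\<And>x. bdry G z x = int q * b x"
    "real (\<Sum>p\<in>supp z. nat \<bar>z p\<bar>) \<le> real q * norm1 c + 1"
proof -
  have fin: "finite (supp c)" using assms(1) by (simp add: chains2'_def)
  define k where "k = card (supp c)"
  obtain e where e: "bij_betw e {..<k} (supp c)"
    using ex_bij_betw_nat_finite[OF fin] unfolding k_def atLeast0LessThan by blast
  \<comment> \<open>With this precision, \<open>k\<close> errors weighted by \<open>3\<close> add up
    to at most \<open>3 k / (4 k + 1) < 1\<close>.\<close>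
  have "\<exists>Q>0. \<exists>r. \<forall>i<k. \<bar>of_int Q * c (e i) - of_int (r i)\<bar> < 1 / real (4 * k + 1)"
    by (rule Dirichlet_approx_simult[of "4 * k + 1" k "\<lambda>i. c (e i)"]) (simp, blast)
  then obtain Q r where Qr: "0 < Q"
    "\<And>i. i < k \<Longrightarrow> \<bar>of_int Q * c (e i) - of_int (r i)\<bar> < 1 / real (4 * k + 1)"
    by blast
  define z where "z p = (if p \<in> supp c then r (the_inv_into {..<k} e p) else 0)" for p
  have supp_z: "supp z \<subseteq> supp c" by (auto simp: supp_def z_def)
  then have fin_z: "finite (supp z)" using fin finite_subset by blast
  have close: "\<bar>of_int Q * c p - of_int (z p)\<bar> < 1 / real (4 * k + 1)" if p: "p \<in> supp c" for p
  proof -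
    let ?i = "the_inv_into {..<k} e p"
    have "?i < k" "e ?i = p"
      using e p the_inv_into_into[of e "{..<k}" p "{..<k}"] f_the_inv_into_f[of e "{..<k}" p]
      by (auto simp: bij_betw_def)
    then show ?thesis using Qr(2)[of ?i] p by (simp add: z_def)
  qed
  have sum_close: "(\<Sum>p\<in>supp c. 3 * \<bar>of_int Q * c p - of_int (z p)\<bar>) < 1"
  proof -
    have "(\<Sum>p\<in>supp c. 3 * \<bar>of_int Q * c p - of_int (z p)\<bar>) \<le> (\<Sum>p\<in>supp c. 3 * (1 / real (4 * k + 1)))"
      by (intro sum_mono mult_left_mono less_imp_le close) auto
    also have "\<dots> = 3 * real k / real (4 * k + 1)" by (simp add: k_def)
    also have "\<dots> < 1" by (simp add: divide_less_eq)
    finally show ?thesis .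
  qed
  \<comment> \<open>Each simplex enters the coefficient at \<open>x\<close> with a factor of
    absolute value at most \<open>3\<close>. Both sides are integers at distance less than
    one.\<close>
  have bdry_z: "bdry G z x = Q * b x" for x
  proof -
    define w :: "'a \<times> 'a \<Rightarrow> int" where
      "w p = of_bool (snd p = x) - of_bool (fst p \<otimes>\<^bsub>G\<^esub> snd p = x) + of_bool (fst p = x)" for p
    have "real_of_int (bdry G z x) = (\<Sum>p\<in>supp c. of_int (z p) * of_int (w p))"
      by (simp add: bdry_superset[OF fin supp_z] w_def)
    moreover have "real_of_int (b x) = (\<Sum>p\<in>supp c. c p * of_int (w p))"
      using fun_cong[OF assms(2), of x] by (simp add: bdry_def w_def)
    then have "real_of_int (Q * b x) = (\<Sum>p\<in>supp c. of_int Q * c p * of_int (w p))"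
      by (simp add: sum_distrib_left mult.assoc)
    ultimately have "real_of_int (Q * b x - bdry G z x)
        = (\<Sum>p\<in>supp c. (of_int Q * c p - of_int (z p)) * of_int (w p))"
      by (simp add: sum_subtractf left_diff_distrib)
    also have "\<bar>\<dots>\<bar> \<le> (\<Sum>p\<in>supp c. 3 * \<bar>of_int Q * c p - of_int (z p)\<bar>)"
    proof (rule order_trans[OF sum_abs sum_mono])
      fix p
      have "\<bar>real_of_int (w p)\<bar> \<le> 3" by (simp add: w_def)
      then show "\<bar>(of_int Q * c p - of_int (z p)) * of_int (w p)\<bar> \<le> 3 * \<bar>of_int Q * c p - of_int (z p)\<bar>"
        by (simp add: abs_mult mult.commute[of _ "\<bar>real_of_int (w p)\<bar>"] mult_right_mono)
    qed
    also have "\<dots> < 1" by (rule sum_close)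
    finally show ?thesis by linarith
  qed
  have "real (\<Sum>p\<in>supp z. nat \<bar>z p\<bar>) = (\<Sum>p\<in>supp z. \<bar>real_of_int (z p)\<bar>)"
    by simp
  also have "\<dots> = (\<Sum>p\<in>supp c. \<bar>real_of_int (z p)\<bar>)"
    by (rule sum.mono_neutral_left) (use fin supp_z in \<open>auto simp: supp_def\<close>)
  also have "\<dots> \<le> (\<Sum>p\<in>supp c. of_int Q * \<bar>c p\<bar> + 3 * \<bar>of_int Q * c p - of_int (z p)\<bar>)"
  proof (rule sum_mono)
    fix p
    \<comment> \<open>The factor \<open>3\<close> allows \<open>sum_close\<close> to be reused for
      the norm.\<close>
    have weaken: "x \<le> y + t \<Longrightarrow> 0 \<le> t \<Longrightarrow> x \<le> y + 3 * t" for x y t :: real by simp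
    have "\<bar>real_of_int (z p)\<bar> \<le> \<bar>of_int Q * c p\<bar> + \<bar>of_int Q * c p - of_int (z p)\<bar>" by linarith
    moreover have "\<bar>of_int Q * c p\<bar> = of_int Q * \<bar>c p\<bar>" using Qr(1) by (simp add: abs_mult)
    ultimately show "\<bar>real_of_int (z p)\<bar> \<le> of_int Q * \<bar>c p\<bar> + 3 * \<bar>of_int Q * c p - of_int (z p)\<bar>"
      by (intro weaken) simp_all
  qed
  also have "\<dots> \<le> real (nat Q) * norm1 c + 1"
    using sum_close Qr(1) by (simp add: sum.distrib norm1_def sum_distrib_left)
  finally have "real (\<Sum>p\<in>supp z. nat \<bar>z p\<bar>) \<le> real (nat Q) * norm1 c + 1" .
  moreover have "z \<in> chains2' G N"
    using fin_z supp_z assms(1) unfolding chains2'_def by blast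
  ultimately show thesis
    by (intro that[of "nat Q" z]) (use Qr(1) bdry_z in simp_all)
qed

section \<open>From fillings of powers to commutator lengths\<close>

context mixed_scl
begin

text \<open>Powers that coincide or cancel are kept as separate letters, so the size does not depend
  on \<open>n\<close>.\<close>

definition pow_letters :: "nat \<Rightarrow> ('a \<Rightarrow> int) \<Rightarrow> (bool \<times> 'a) multiset" where
  "pow_letters n d = image_mset (map_prod id (\<lambda>x. x [^] n)) (signed_mset d)"

lemma powchain_eq:
  assumes "finite (supp d)"
  shows "powchain G n d = (\<lambda>y. real_of_int (chain_of (pow_letters n d) y))"
proof
  fix y
  have "real_of_int (chain_of (pow_letters n d) y) = (\<Sum>x\<in>supp d. if x [^] n = y then real_of_int (d x) else 0)"
    unfolding pow_letters_def chain_of_image_signed_mset[OF assms]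
    by (simp, rule sum.cong) auto
  also have "\<dots> = powchain G n d y"
    unfolding powchain_def sum.inter_filter[OF assms] ..
  finally show "powchain G n d y = real_of_int (chain_of (pow_letters n d) y)" ..
qed

lemma lval_pow_letters:
  assumes "supp d \<subseteq> carrier G"
  shows "image_mset lval (pow_letters n d) = pow_mset n (image_mset lval (signed_mset d))"
  unfolding pow_letters_def image_mset.compositionality
  by (rule image_mset_cong) (use assms in \<open>auto simp: lval_def inv_nat_pow dest!: signed_msetD\<close>)

lemma chain_mset_eq: "chain_mset G d = image_mset lval (signed_mset d)"
proof -
  have "image_mset lval (signed_mset d)
      = (\<Sum>x\<in>supp d. image_mset lval (replicate_mset (nat \<bar>d x\<bar>) (0 < d x, x)))"
    unfolding signed_mset_def
    by (induction rule: infinite_finite_induct) (simp_all del: image_replicate_mset)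
  then show ?thesis
    unfolding chain_mset_def by (auto simp: lval_def supp_def intro!: sum.cong)
qed

text \<open>Of the constant \<open>7\<close>, the annuli contribute \<open>3\<close>, and joining
  the \<open>q\<close> copies of each \<open>n\<close>-th power contributes \<open>4\<close>, four
  times one commutator per copy.\<close>

lemma cl_le_of_real_filling:
  fixes c :: "'a \<times> 'a \<Rightarrow> real"
  assumes "finite (supp d)" "supp d \<subseteq> N"
    and "c \<in> chains2' G N" "bdry G c = powchain G n d"
  shows "\<exists>q m. 0 < q \<and> cl_le m (pow_mset (n * q) (chain_mset G d)) \<and>
    4 * real m \<le> real q * norm1 c + 1 + 7 * real q * real (size (chain_mset G d))"
proof -
  obtain q z where qz: "0 < q" "z \<in> chains2' G N"
    "\<And>x. bdry G z x = int q * chain_of (pow_letters n d) x"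
    "real (\<Sum>p\<in>supp z. nat \<bar>z p\<bar>) \<le> real q * norm1 c + 1"
    by (rule integral_filling_approx[OF assms(3) assms(4)[unfolded powchain_eq[OF assms(1)]]]) blast
  define M where "M = chain_mset G d"
  have M: "set_mset M \<subseteq> N"
    unfolding M_def chain_mset_eq using assms(2) by (auto dest!: signed_msetD)
  have size: "size (pow_letters n d) = size M"
    by (simp add: pow_letters_def M_def chain_mset_eq)
  have "snd ` set_mset (repeat_mset q (pow_letters n d)) \<subseteq> N"
    using assms(2) by (induction q) (auto simp: pow_letters_def dest!: signed_msetD)
  moreover have "bdry G z x = chain_of (repeat_mset q (pow_letters n d)) x" for x
    unfolding chain_of_repeat by (rule qz(3))
  ultimately obtain m where m: "cl_le m (image_mset lval (repeat_mset q (pow_letters n d)))"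
    "4 * m \<le> size (signed_mset z) + 3 * size (repeat_mset q (pow_letters n d))"
    using cl_le_of_integral_filling[OF qz(2), of "repeat_mset q (pow_letters n d)"] by blast
  have "image_mset lval (repeat_mset q (pow_letters n d)) = repeat_mset q (pow_mset n M)"
  proof -
    have "image_mset lval (repeat_mset q S) = repeat_mset q (image_mset lval S)" for S
      by (induction q) simp_all
    moreover have "image_mset lval (pow_letters n d) = pow_mset n (image_mset lval (signed_mset d))"
      using assms(2) by (intro lval_pow_letters) auto
    ultimately show ?thesis by (simp add: M_def chain_mset_eq)
  qed
  with m(1) have "cl_le (m + q * size M) (pow_mset (n * q) M)"
    using cl_le_pow_mult[OF M _ qz(1)] by simp
  moreover have "4 * real (m + q * size M) \<le> real q * norm1 c + 1 + 7 * real q * real (size M)"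
  proof -
    have "finite (supp z)" using qz(2) by (simp add: chains2'_def)
    then have "size (signed_mset z) = (\<Sum>p\<in>supp z. nat \<bar>z p\<bar>)"
      by (rule size_signed_mset)
    then have "4 * m \<le> (\<Sum>p\<in>supp z. nat \<bar>z p\<bar>) + 3 * (q * size M)"
      using m(2) size by simp
    then have "real (4 * m) \<le> real ((\<Sum>p\<in>supp z. nat \<bar>z p\<bar>) + 3 * (q * size M))"
      by (rule of_nat_mono)
    then have "real (4 * m) \<le> real (\<Sum>p\<in>supp z. nat \<bar>z p\<bar>) + real (3 * (q * size M))"
      unfolding of_nat_add .
    then show ?thesis using qz(4) by (simp add: algebra_simps del: of_nat_sum)
  qed
  ultimately show ?thesis using qz(1) unfolding M_def by blast
qed

end

subsection \<open>Filling norms and limits\<close>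

context mixed_scl
begin

text \<open>Carrying an explicit filling avoids the infimum in \<open>fnorm'\<close>, which is only
  meaningful when some filling exists.\<close>

definition fillable :: "real \<Rightarrow> ('a \<Rightarrow> real) \<Rightarrow> bool" where
  "fillable t c \<longleftrightarrow> (\<exists>c'\<in>chains2' G N. bdry G c' = c \<and> norm1 c' \<le> t)"

lemma fillable_lincomb:
  assumes "fillable s a" "fillable t b"
  shows "fillable (s + \<bar>k\<bar> * t) (\<lambda>x. a x + k * b x)"
proof -
  obtain a' b' where a': "a' \<in> chains2' G N" "bdry G a' = a" "norm1 a' \<le> s"
    and b': "b' \<in> chains2' G N" "bdry G b' = b" "norm1 b' \<le> t"
    using assms by (auto simp: fillable_def)
  define S where "S = supp a' \<union> supp b'"
  define e where "e p = a' p + k * b' p" for p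
  have S: "finite S" "supp a' \<subseteq> S" "supp b' \<subseteq> S" "supp e \<subseteq> S"
    using a' b' by (auto simp: S_def chains2'_def e_def supp_def)
  have norm1: "norm1 c = (\<Sum>p\<in>S. \<bar>c p\<bar>)" if "supp c \<subseteq> S" for c
    unfolding norm1_def by (rule sum.mono_neutral_left) (use that S in \<open>auto simp: supp_def\<close>)
  have "bdry G e x = bdry G a' x + k * bdry G b' x" for x
    unfolding bdry_superset[OF S(1) S(2)] bdry_superset[OF S(1) S(3)] bdry_superset[OF S(1) S(4)]
      e_def sum_distrib_left sum.distrib[symmetric]
    by (rule sum.cong) (simp_all add: algebra_simps)
  moreover have "norm1 e \<le> norm1 a' + \<bar>k\<bar> * norm1 b'"
    unfolding norm1[OF S(2)] norm1[OF S(3)] norm1[OF S(4)] sum_distrib_left sum.distrib[symmetric]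
    by (rule sum_mono) (auto simp: e_def abs_mult[symmetric] intro: abs_triangle_ineq)
  moreover have "\<bar>k\<bar> * norm1 b' \<le> \<bar>k\<bar> * t"
    using b' by (intro mult_left_mono) auto
  moreover have "e \<in> chains2' G N"
    using S finite_subset[OF S(4) S(1)] a'(1) b'(1) by (auto simp: chains2'_def S_def)
  ultimately show ?thesis
    using a' b' by (auto simp: fillable_def intro!: bexI[of _ e])
qed

lemma fillable_add: "\<lbrakk>fillable s a; fillable t b\<rbrakk> \<Longrightarrow> fillable (s + t) (\<lambda>x. a x + b x)"
  using fillable_lincomb[of s a t b 1] by simp

lemma fillable_diff: "\<lbrakk>fillable s a; fillable t b\<rbrakk> \<Longrightarrow> fillable (s + t) (\<lambda>x. a x - b x)"
  using fillable_lincomb[of s a t b "-1"] by simp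

lemma fillable_zero: "fillable 0 (\<lambda>_. 0)"
  unfolding fillable_def by (rule bexI[of _ "\<lambda>_. 0"]) (auto simp: chains2'_def supp_def bdry_def norm1_def)

definition dirac :: "'a \<Rightarrow> 'a \<Rightarrow> real" where
  "dirac a x = of_bool (a = x)"

lemma fillable_triangle:
  assumes "a \<in> carrier G" "b \<in> carrier G" "a \<in> N \<or> b \<in> N"
  shows "fillable 1 (\<lambda>x. dirac a x + dirac b x - dirac (a \<otimes> b) x)"
proof -
  let ?c = "\<lambda>p. of_bool (p = (a, b)) :: real"
  have supp: "supp ?c = {(a, b)}" by (auto simp: supp_def)
  then show ?thesis
    unfolding fillable_def using assms
    by (intro bexI[of _ ?c]) (auto simp: chains2'_def bdry_def norm1_def dirac_def)
qed

text \<open>The filling is the simplex \<open>(g, x)\<close> minus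
  \<open>(g \<otimes> x \<otimes> inv g, g)\<close>: the terms \<open>g\<close> and
  \<open>g \<otimes> x\<close> cancel.\<close>

lemma fillable_conj:
  assumes "x \<in> N" "g \<in> carrier G"
  shows "fillable 2 (\<lambda>z. dirac x z - dirac (g \<otimes> x \<otimes> inv g) z)"
proof -
  have "g \<otimes> x \<otimes> inv g \<otimes> g = g \<otimes> x" using assms by (simp add: word_simps)
  then show ?thesis
    using fillable_diff[OF fillable_triangle[of g x] fillable_triangle[of "g \<otimes> x \<otimes> inv g" g]] assms
    by (simp add: algebra_simps)
qed

text \<open>The simplex \<open>([g, x], x)\<close> has boundary
  \<open>[g, x] + x - g \<otimes> x \<otimes> inv g\<close>; the surplus is filled by
  \<open>fillable_conj\<close>.\<close>

lemma fillable_comm: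
  assumes "x \<in> N" "g \<in> carrier G"
  shows "fillable 3 (dirac (g \<otimes> x \<otimes> inv g \<otimes> inv x))"
proof -
  have "g \<otimes> x \<otimes> inv g \<otimes> inv x \<otimes> x = g \<otimes> x \<otimes> inv g" using assms by (simp add: word_simps)
  then show ?thesis
    using fillable_diff[OF fillable_triangle[of "g \<otimes> x \<otimes> inv g \<otimes> inv x" x] fillable_conj[OF assms]] assms
    by (simp add: algebra_simps)
qed

lemma fillable_one: "fillable 1 (dirac \<one>)"
  using fillable_triangle[of \<one> \<one>] by simp

text \<open>Each commutator costs \<open>3\<close>, and multiplying it to the rest one more simplex.
  This is the factor \<open>4\<close> of the upper bound on \<open>fl\<close>; the final
  \<open>1\<close> fills \<open>\<one>\<close>.\<close>

lemma fillable_comm_prod: "comm_prod n h \<Longrightarrow> fillable (4 * real n + 1) (dirac h)"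
proof (induction rule: comm_prod.induct)
  case comm_prod_0
  then show ?case using fillable_one by simp
next
  case (comm_prod_Suc g x n h)
  let ?c = "g \<otimes> x \<otimes> inv g \<otimes> inv x"
  have "fillable (3 + (4 * real n + 1) + 1)
      (\<lambda>z. dirac ?c z + dirac h z - (dirac ?c z + dirac h z - dirac (?c \<otimes> h) z))"
    using comm_prod_Suc
    by (intro fillable_diff fillable_add fillable_comm fillable_triangle) auto
  then show ?case by (simp add: algebra_simps)
qed

text \<open>Each factor costs \<open>2\<close> to remove its conjugator and \<open>1\<close> to be
  multiplied.\<close>

lemma fillable_cprod:
  "conj_pairs L \<Longrightarrow>
    fillable (3 * real (length L) + 1) (\<lambda>z. real (count (mset (map snd L)) z) - dirac (cprod L) z)"
proof (induction L)
  case Nil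
  then show ?case using fillable_diff[OF fillable_zero fillable_one] by simp
next
  case (Cons p L)
  let ?x = "snd p" and ?y = "fst p \<otimes> snd p \<otimes> inv (fst p)"
  have "fillable (3 * real (length L) + 1 + 2 + 1)
      (\<lambda>z. real (count (mset (map snd L)) z) - dirac (cprod L) z + (dirac ?x z - dirac ?y z)
         + (dirac ?y z + dirac (cprod L) z - dirac (?y \<otimes> cprod L) z))"
    using Cons by (intro fillable_add fillable_conj fillable_triangle) auto
  moreover have "(\<lambda>z. real (count (mset (map snd L)) z) - dirac (cprod L) z + (dirac ?x z - dirac ?y z)
         + (dirac ?y z + dirac (cprod L) z - dirac (?y \<otimes> cprod L) z))
      = (\<lambda>z. real (count (mset (map snd (p # L))) z) - dirac (cprod (p # L)) z)"
    by (auto simp: dirac_def)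
  ultimately show ?case by (simp add: algebra_simps)
qed

lemma fillable_of_cl_le:
  assumes "cl_le n M"
  shows "fillable (4 * real n + 3 * real (size M) + 2) (\<lambda>x. real (count M x))"
proof -
  obtain L where L: "conj_pairs L" "mset (map snd L) = M" "comm_prod n (cprod L)"
    using assms by (auto simp: cl_le_def)
  have "size M = length L" unfolding L(2)[symmetric] by simp
  with fillable_add[OF fillable_cprod[OF L(1)] fillable_comm_prod[OF L(3)]] L(2) show ?thesis
    by (simp add: algebra_simps)
qed

text \<open>A term \<open>- a\<close> is exchanged for \<open>inv a\<close> by the simplex
  \<open>(a, inv a)\<close>, whose boundary is \<open>a + inv a - \<one>\<close>, together with a
  filling of \<open>\<one>\<close>.\<close>

lemma fillable_signs:
  "snd ` set_mset S \<subseteq> N \<Longrightarrow>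
    fillable (2 * real (size S)) (\<lambda>x. of_int (chain_of S x) - real (count (image_mset lval S) x))"
proof (induction S)
  case empty
  then show ?case using fillable_zero by simp
next
  case (add l S)
  obtain s a where l: "l = (s, a)" by (cases l)
  have "fillable 2 (\<lambda>x. (if s then 1 else - 1) * of_bool (a = x) - of_bool (lval l = x))"
  proof (cases s)
    case True
    then show ?thesis
      using fillable_diff[OF fillable_one fillable_one] l by (simp add: lval_def)
  next
    case False
    have "fillable (0 + (1 + 1)) (\<lambda>x. 0 - (dirac a x + dirac (inv a) x - dirac (a \<otimes> inv a) x + dirac \<one> x))"
      using add.prems l
      by (intro fillable_diff fillable_add fillable_zero fillable_one fillable_triangle) auto
    then show ?thesis using False l add.prems by (simp add: lval_def dirac_def algebra_simps)
  qed
  moreover have "fillable (2 * real (size S)) (\<lambda>x. of_int (chain_of S x) - real (count (image_mset lval S) x))"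
    using add by auto
  ultimately have "fillable (2 + 2 * real (size S))
      (\<lambda>x. (if s then 1 else - 1) * of_bool (a = x) - of_bool (lval l = x)
         + (of_int (chain_of S x) - real (count (image_mset lval S) x)))"
    by (rule fillable_add)
  moreover have "(\<lambda>x. (if s then 1 else - 1) * of_bool (a = x) - of_bool (lval l = x)
         + (of_int (chain_of S x) - real (count (image_mset lval S) x)))
      = (\<lambda>x. of_int (chain_of (add_mset l S) x) - real (count (image_mset lval (add_mset l S)) x))"
    by (auto simp: l)
  ultimately show ?case by (simp add: algebra_simps)
qed

lemma fillable_powchain:
  assumes "finite (supp d)" "supp d \<subseteq> N" "cl_le m (pow_mset n (chain_mset G d))"
  shows "fillable (4 * real m + 5 * real (size (chain_mset G d)) + 2) (powchain G n d)"
proof -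
  let ?S = "pow_letters n d"
  have lval: "image_mset lval ?S = pow_mset n (chain_mset G d)"
    unfolding chain_mset_eq using assms(2) by (intro lval_pow_letters) auto
  have size: "size ?S = size (chain_mset G d)"
    by (simp add: pow_letters_def chain_mset_eq)
  have "snd ` set_mset ?S \<subseteq> N"
    using assms(2) by (auto simp: pow_letters_def dest!: signed_msetD)
  from fillable_add[OF fillable_of_cl_le[OF assms(3)] fillable_signs[OF this]] show ?thesis
    unfolding powchain_eq[OF assms(1)] lval size by (simp add: size algebra_simps)
qed

section \<open>Bounds for the filling norm and limits\<close>

lemma norm1_nonneg: "0 \<le> norm1 c"
  by (simp add: norm1_def sum_nonneg)

lemma fnorm'_le: "fillable t c \<Longrightarrow> fnorm' G N c \<le> t"
proof -
  assume "fillable t c"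
  then obtain c' where c': "c' \<in> chains2' G N" "bdry G c' = c" "norm1 c' \<le> t"
    by (auto simp: fillable_def)
  have "fnorm' G N c \<le> norm1 c'"
    unfolding fnorm'_def using c' norm1_nonneg
    by (intro cInf_lower bdd_belowI[of _ 0]) auto
  then show ?thesis using c' by simp
qed

text \<open>The first assumption makes the set of norms nonempty, as a lower bound for its infimum
  requires.\<close>

lemma fnorm'_ge:
  assumes "fillable t c" "\<And>c'. \<lbrakk>c' \<in> chains2' G N; bdry G c' = c\<rbrakk> \<Longrightarrow> B \<le> norm1 c'"
  shows "B \<le> fnorm' G N c"
  unfolding fnorm'_def using assms by (intro cInf_greatest) (auto simp: fillable_def)

end

text \<open>The sequence \<open>a n + b\<close> is subadditive, so Fekete's lemma applies to it, and
  the limit is the infimum of \<open>(a n + b) / n\<close>. The bound at every single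
  \<open>n\<close> is what the comparison with fillings needs.\<close>

lemma fekete:
  fixes a :: "nat \<Rightarrow> real"
  assumes nonneg: "\<And>n. 0 \<le> a n" and "0 \<le> b" and sub: "\<And>i j. a (i + j) \<le> a i + a j + b"
  obtains L where "(\<lambda>n. a n / real n) \<longlonglongrightarrow> L" "\<And>n. 0 < n \<Longrightarrow> L * real n \<le> a n + b"
proof -
  define u where "u n = a n + b" for n
  have u0: "0 \<le> u n" for n using nonneg[of n] \<open>0 \<le> b\<close> by (simp add: u_def)
  have u_sub: "u (i + j) \<le> u i + u j" for i j using sub[of i j] by (simp add: u_def)
  define L where "L = (INF n\<in>{0<..}. u n / real n)"
  have bdd: "bdd_below ((\<lambda>n. u n / real n) ` {0<..})"
    by (rule bdd_belowI[of _ 0]) (auto simp: u0)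
  have L_le: "L \<le> u n / real n" if "0 < n" for n
    unfolding L_def using that by (intro cINF_lower bdd) auto
  have u_mult: "u (q * m + r) \<le> real q * u m + u r" for q m r
  proof (induction q)
    case (Suc q)
    have "u (Suc q * m + r) \<le> u m + u (q * m + r)"
      using u_sub[of m "q * m + r"] by (simp add: algebra_simps)
    then show ?case using Suc by (simp add: algebra_simps)
  qed simp
  have lim: "(\<lambda>n. u n / real n) \<longlonglongrightarrow> L"
  proof (rule LIMSEQ_I)
    fix e :: real assume "0 < e"
    have "\<exists>m\<in>{0<..}. u m / real m < L + e / 2"
      using cINF_less_iff[OF _ bdd, of "L + e / 2"] \<open>0 < e\<close> unfolding L_def by auto
    then obtain m where m: "0 < m" "u m / real m < L + e / 2" by auto
    define C where "C = (\<Sum>r<m. u r)"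
    have C: "u r \<le> C" if "r < m" for r
      unfolding C_def using that u0 by (intro member_le_sum) auto
    obtain n0 :: nat where n0: "2 * C / e < real n0" using reals_Archimedean2 by blast
    show "\<exists>no. \<forall>n\<ge>no. norm (u n / real n - L) < e"
    proof (intro exI allI impI)
      fix n assume n: "Suc n0 \<le> n"
      then have "0 < n" "2 * C / e < real n" using n0 by linarith+
      then have "C / real n < e / 2" using \<open>0 < e\<close> by (simp add: field_simps)
      \<comment> \<open>Division by an \<open>m\<close> that almost attains the infimum: the
        remainder contributes at most \<open>C\<close>, which is negligible against
        \<open>n\<close>.\<close>
      have "u n = u (n div m * m + n mod m)" by simp
      also have "\<dots> \<le> real (n div m) * u m + u (n mod m)" by (rule u_mult)
      also have "\<dots> \<le> real (n div m) * u m + C" using C m by simp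
      finally have "u n / real n \<le> (real (n div m) * u m + C) / real n"
        by (rule divide_right_mono) simp
      also have "\<dots> = real (n div m * m) / real n * (u m / real m) + C / real n"
        using m by (simp add: add_divide_distrib)
      also have "real (n div m * m) / real n * (u m / real m) \<le> 1 * (u m / real m)"
        using u0[of m] \<open>0 < n\<close> by (intro mult_right_mono) (simp_all del: of_nat_mult)
      finally have "u n / real n < L + e"
        using m(2) \<open>C / real n < e / 2\<close> by linarith
      then show "norm (u n / real n - L) < e"
        using L_le[OF \<open>0 < n\<close>] by simp
    qed
  qed
  have "(\<lambda>n. u n / real n - b / real n) \<longlonglongrightarrow> L - 0"
    by (intro tendsto_diff lim tendsto_divide_0[OF tendsto_const] filterlim_at_top_imp_at_infinity
        filterlim_real_sequentially)
  moreover have "(\<lambda>n. u n / real n - b / real n) = (\<lambda>n. a n / real n)"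
    by (simp add: u_def add_divide_distrib)
  ultimately have "(\<lambda>n. a n / real n) \<longlonglongrightarrow> L" by simp
  moreover have "L * real n \<le> a n + b" if "0 < n" for n
    using L_le[OF that] that by (simp add: u_def field_simps)
  ultimately show thesis by (rule that)
qed

section \<open>Integral and rational chains\<close>

context mixed_scl
begin

text \<open>Gluing an integral filling of \<open>d\<close> shows that the commutator length of
  \<open>d\<close> is finite.\<close>

lemma integral_cl_le:
  assumes "d \<in> calC G N"
  shows "\<exists>m. cl_le m (chain_mset G d)"
proof -
  obtain z :: "'a \<times> 'a \<Rightarrow> int" where z: "z \<in> chains2' G N" "d = bdry G z"
    using assms by (auto simp: calC_def bdries1'_def)
  have d: "finite (supp d)" "supp d \<subseteq> N" using assms by (auto simp: calC_def chains1_def)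
  have "chain_of (signed_mset d) x = d x" for x
    using chain_of_image_signed_mset[OF d(1), of id x] d(1)
    by (auto simp: supp_def prod.map_id0 sum.If_cases Int_def if_distrib of_bool_def
        cong: if_cong split: if_splits)
  moreover have "snd ` set_mset (signed_mset d) \<subseteq> N"
    using d(2) by (auto dest!: signed_msetD)
  ultimately show ?thesis
    using cl_le_of_integral_filling[OF z(1), of "signed_mset d"] z(2) by (auto simp: chain_mset_eq)
qed

lemma cl_le_pow_exists:
  assumes "set_mset M \<subseteq> N" "cl_le m M"
  shows "\<exists>k. cl_le k (pow_mset n M)"
proof (induction n)
  case 0
  have "cl_le 0 {#\<one>#}"
    using cl_le_add_msetI[of \<one> \<one> "[]" 0] by (simp add: comm_prod_0)
  then have "cl_le 0 (image_mset (\<lambda>_. \<one>) M)" for M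
    by (induction M) (use cl_le_empty cl_le_add[of 0 "{#\<one>#}" 0] in auto)
  then show ?case by auto
next
  case (Suc n)
  have "pow_mset 1 M = image_mset id M"
    using assms(1) by (intro image_mset_cong) auto
  then have "cl_le m (pow_mset 1 M)" using assms(2) by simp
  then show ?case using Suc cl_le_pow_add[OF assms(1), of _ n m 1] by auto
qed

text \<open>Up to constants independent of \<open>n\<close>, the norm of the \<open>n\<close>-th
  power chain lies between \<open>4 * L * n\<close> and \<open>4 * a n\<close>, where
  \<open>L\<close> is the limit of \<open>a n / n\<close>.\<close>

lemma integral_scl_fl:
  assumes "d \<in> calC G N"
  shows "4 * sclZ G N d = flZ G N d"
proof -
  have d: "finite (supp d)" "supp d \<subseteq> N" using assms by (auto simp: calC_def chains1_def)
  define M where "M = chain_mset G d"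
  have M: "set_mset M \<subseteq> N"
    unfolding M_def chain_mset_eq using d by (auto dest!: signed_msetD)
  define xs where "xs = (SOME xs. mset xs = M)"
  have xs: "mset xs = M" unfolding xs_def by (rule someI_ex) (rule ex_mset)
  define a where "a n = cl_list G N (map (\<lambda>x. x [^] n) xs)" for n :: nat
  have mset_pow: "mset (map (\<lambda>x. x [^] n) xs) = pow_mset n M" for n :: nat
    using xs by simp
  have ex: "\<exists>k. cl_le k (pow_mset n M)" for n
    using integral_cl_le[OF assms] cl_le_pow_exists[OF M] by (auto simp: M_def)
  have cl_a: "cl_le (a n) (pow_mset n M)" for n
    using ex[of n] cl_le_cl_list[of _ "map (\<lambda>x. x [^] n) xs"] unfolding mset_pow a_def by blast
  have a_le: "a n \<le> k" if "cl_le k (pow_mset n M)" for n k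
    using cl_list_le[of k "map (\<lambda>x. x [^] n) xs"] that unfolding mset_pow a_def by blast
  define b where "b = real (size M)"
  have "real (a (i + j)) \<le> real (a i) + real (a j) + b" for i j
  proof -
    have "a (i + j) \<le> a i + a j + size M"
      by (rule a_le) (rule cl_le_pow_add[OF M cl_a cl_a])
    then have "real (a (i + j)) \<le> real (a i + a j + size M)" by (rule of_nat_mono)
    then show ?thesis by (simp add: b_def)
  qed
  then obtain L where L: "(\<lambda>n. real (a n) / real n) \<longlonglongrightarrow> L"
    "\<And>n. 0 < n \<Longrightarrow> L * real n \<le> real (a n) + b"
    using fekete[of "\<lambda>n. real (a n)" b] by (auto simp: b_def)
  define f where "f n = fnorm' G N (powchain G n d)" for n
  have fill: "fillable (4 * real (a n) + 5 * b + 2) (powchain G n d)" for n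
    using fillable_powchain[OF d, of "a n" n] cl_a[of n] by (simp add: M_def b_def)
  have upper: "f n \<le> 4 * real (a n) + (5 * b + 2)" for n
    using fnorm'_le[OF fill, of n] by (simp add: f_def)
  \<comment> \<open>The number \<open>q\<close> depends on the filling, so \<open>L\<close> is
    compared with \<open>a (n * q)\<close> at that very exponent, and the inequality is divided by
    \<open>q\<close>.\<close>
  have lower: "4 * L * real n - (1 + 11 * b) \<le> f n" if n: "0 < n" for n
    unfolding f_def
  proof (rule fnorm'_ge[OF fill])
    fix c :: "'a \<times> 'a \<Rightarrow> real"
    assume "c \<in> chains2' G N" "bdry G c = powchain G n d"
    from cl_le_of_real_filling[OF d this] obtain q m where qm: "0 < q"
      "cl_le m (pow_mset (n * q) M)" "4 * real m \<le> real q * norm1 c + 1 + 7 * real q * b"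
      by (auto simp: M_def b_def)
    have "L * real (n * q) \<le> real m + b"
      using L(2)[of "n * q"] a_le[OF qm(2)] n qm(1) by simp
    then have "real q * (4 * L * real n) \<le> real q * norm1 c + 1 + 7 * real q * b + 4 * b"
      using qm(3) by (simp add: algebra_simps)
    \<comment> \<open>All error terms become multiples of \<open>q\<close>; \<open>7 + 4\<close>
      gives the constant \<open>11\<close>.\<close>
    also have "\<dots> \<le> real q * norm1 c + real q * 1 + 7 * real q * b + 4 * (real q * b)"
    proof -
      have "1 \<le> real q" using qm(1) by simp
      moreover from this have "b \<le> real q * b"
        using mult_right_mono[of 1 "real q" b] by (simp add: b_def)
      ultimately show ?thesis by linarith
    qed
    also have "\<dots> = real q * (norm1 c + (1 + 11 * b))" by (simp add: algebra_simps)
    finally have "4 * L * real n \<le> norm1 c + (1 + 11 * b)"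
      using qm(1) by simp
    then show "4 * L * real n - (1 + 11 * b) \<le> norm1 c" by simp
  qed
  have const: "(\<lambda>n. k / real n) \<longlonglongrightarrow> 0" for k :: real
    by (intro tendsto_divide_0[OF tendsto_const] filterlim_at_top_imp_at_infinity
        filterlim_real_sequentially)
  have "(\<lambda>n. f n / real n) \<longlonglongrightarrow> 4 * L"
  proof (rule tendsto_sandwich)
    show "\<forall>\<^sub>F n in sequentially. 4 * L - (1 + 11 * b) / real n \<le> f n / real n"
      using eventually_gt_at_top[of 0]
    proof eventually_elim
      case (elim n)
      then show ?case
        using divide_right_mono[OF lower[OF elim], of "real n"] by (simp add: diff_divide_distrib)
    qed
    show "\<forall>\<^sub>F n in sequentially. f n / real n \<le> 4 * (real (a n) / real n) + (5 * b + 2) / real n"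
      using eventually_gt_at_top[of 0]
    proof eventually_elim
      case (elim n)
      show ?case
        using divide_right_mono[OF upper, of "real n" n] by (simp add: add_divide_distrib)
    qed
    show "(\<lambda>n. 4 * L - (1 + 11 * b) / real n) \<longlonglongrightarrow> 4 * L"
      using tendsto_diff[OF tendsto_const const] by simp
    show "(\<lambda>n. 4 * (real (a n) / real n) + (5 * b + 2) / real n) \<longlonglongrightarrow> 4 * L"
      using tendsto_add[OF tendsto_mult[OF tendsto_const L(1)] const] by simp
  qed
  then have "flZ G N d = 4 * L" unfolding flZ_def f_def by (rule limI)
  moreover have "sclZ G N d = L"
    unfolding sclZ_def scl_list_def using limI[OF L(1)] by (simp add: a_def xs_def M_def)
  ultimately show ?thesis by simp
qed

text \<open>The \<open>LEAST\<close> in \<open>denomC\<close> is attained: the denominators of a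
  rational filling, and not only those of \<open>c\<close>, are cleared, so that the multiple of
  \<open>c\<close> has an integral filling.\<close>

lemma clear_denominators_in_calC:
  assumes "c \<in> calC G N"
  shows "(\<lambda>x. \<lfloor>of_nat (denomC G N c) * c x\<rfloor>) \<in> calC G N"
proof -
  let ?P = "\<lambda>m::nat. 0 < m \<and> (\<exists>d \<in> (calC G N :: ('a \<Rightarrow> int) set). (\<lambda>x. of_nat m * c x) = (\<lambda>x. of_int (d x)))"
  obtain c' :: "'a \<times> 'a \<Rightarrow> rat" where c': "c' \<in> chains2' G N" "c = bdry G c'"
    using assms by (auto simp: calC_def bdries1'_def)
  have fin: "finite (supp c')" using c' by (simp add: chains2'_def)
  define m :: nat where "m = nat (\<Prod>p\<in>supp c'. snd (quotient_of (c' p)))"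
  have pos: "0 < (\<Prod>p\<in>supp c'. snd (quotient_of (c' p)))"
    by (intro prod_pos) (simp add: quotient_of_denom_pos')
  then have m: "0 < m" "(of_nat m :: rat) = of_int (\<Prod>p\<in>supp c'. snd (quotient_of (c' p)))"
    by (simp_all add: m_def)
  define z where "z p = \<lfloor>of_nat m * c' p\<rfloor>" for p
  have z: "of_int (z p) = of_nat m * c' p" for p
  proof (cases "p \<in> supp c'")
    case True
    let ?r = "\<Prod>p\<in>supp c' - {p}. snd (quotient_of (c' p))"
    have "c' p = of_int (fst (quotient_of (c' p))) / of_int (snd (quotient_of (c' p)))"
      by (rule quotient_of_div) simp
    then have "of_int (snd (quotient_of (c' p))) * c' p = of_int (fst (quotient_of (c' p)))"
      using quotient_of_denom_pos'[of "c' p"] by (simp add: field_simps)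
    then have "of_nat m * c' p = of_int (?r * fst (quotient_of (c' p)))"
      unfolding m(2) prod.remove[OF fin True] by (simp add: ac_simps)
    then show ?thesis by (simp only: z_def floor_of_int)
  qed (simp add: z_def supp_def)
  have supp_z: "supp z = supp c'" 
    unfolding supp_def using z m(1)
    by (metis (no_types, lifting) mult_eq_0_iff of_int_eq_0_iff of_nat_eq_0_iff less_irrefl)
  have bdry_z: "of_int (bdry G z x) = of_nat m * c x" for x
    unfolding c'(2) bdry_def supp_z by (simp add: z sum_distrib_left mult.assoc)
  have "supp (bdry G z) = supp c"
    unfolding supp_def using bdry_z m(1)
    by (metis (no_types, lifting) mult_eq_0_iff of_int_eq_0_iff of_nat_eq_0_iff less_irrefl)
  then have "bdry G z \<in> calC G N"
    using assms c'(1) supp_z by (auto simp: calC_def chains1_def bdries1'_def chains2'_def)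
  then have "?P m" using m(1) bdry_z by (metis (no_types, lifting))
  then have "?P (denomC G N c)" unfolding denomC_def by (rule LeastI)
  then obtain d :: "'a \<Rightarrow> int" where "d \<in> calC G N" "\<And>x. of_nat (denomC G N c) * c x = of_int (d x)"
    by (auto simp: fun_eq_iff)
  then show ?thesis by simp
qed

end

theorem theorem5p18:
  fixes G :: "('a, 'm) monoid_scheme" and N :: "'a set" and c :: "'a \<Rightarrow> rat"
  assumes "group G" and "N \<lhd> G" and "c \<in> calC G N"
  shows "4 * sclQ G N c = flQ G N c"
proof -
  interpret mixed_scl N G
    unfolding mixed_scl_def by (rule assms(2))
  show ?thesis
    using integral_scl_fl[OF clear_denominators_in_calC[OF assms(3)]]
    by (simp add: sclQ_def flQ_def Let_def)
qed

end
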